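(* Let $d\ge2$ be an integer. There exist two functions $F$ and $G$, defined on finite sequences of nonnegative integers and with nonnegative values, such that the following holds. Let $y>0$ and let $(m_n)_{n\ge0}$, $(q_n)_{n\ge0}$ be sequences of nonnegative integers with $m_0=q_0=0$ such that, writing $N_k=\sum_{j=0}^k(m_j+q_j)$, the iterates $g^{(n)}(y)$ satisfy, for every $k\ge0$, - $\lambda<g^{(n)}(y)$ if $N_k\le n\le N_k+m_{k+1}-1$, - $0<g^{(n)}(y)<\frac12$ if $N_k+m_{k+1}\le n\le N_k+m_{k+1}+q_{k+1}-1$. If for infinitely many $n$ either $m_n>F(m_0,q_0,m_1,q_1,\dots,m_{n-1},q_{n-1})$ or $q_n>G(m_0,q_0,m_1,q_1,\dots,m_{n-1},q_{n-1},m_n)$, then the interval exchange transformation $\mathcal I$ with parameter $y$ is rigid with respect to normalized Lebesgue measure.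
   Context: Fix $d$. Put $\lambda=2\cos^2\frac{\pi}{2d}=1+\cos\frac{\pi}{d}$, and define $g(y)=y-\lambda$ if $y>\lambda$ and $g(y)=\frac{y}{1-2y}$ if $0<y<\frac12$ (values of $g$ elsewhere are irrelevant); $g^{(n)}$ is the $n$-th iterate of $g$. For $0<|\theta|<\frac{\pi}{2d}$, let $\mathcal I$ be the exchange of $d$ intervals on $[-1,1[$ defined as follows: the intervals are the $d$ consecutive semi-open intervals cut out of $[-1,1[$ by the points $\gamma_j=-\cos\frac{j\pi}{d}+\tan\theta\,\sin\frac{j\pi}{d}$, $1\le j\le d-1$, and $\mathcal I$ rearranges them by translations in the reversed order (permutation $p(j)=d-j+1$); thus the discontinuities of $\mathcal I^{-1}$ are $\beta_j=-\gamma_{d-j}$. Changing $\theta$ into $-\theta$ amounts (up to endpoints) to conjugating by $x\mapsto -x$. The family is parametrized by $$y=\frac12\left(\frac{\sin\frac{\pi}{d}}{|\tan\theta|}-\left(1+\cos\frac{\pi}{d}\right)\right)>0.$$ (These maps arise from the billiard flow in direction $\theta$ on the regular $2d$-gon with parallel sides identified.) A measure-preserving system $(X,T,\mu)$ is rigid if there is a sequence of integers $s_n\to\infty$ such that $\mu(T^{s_n}A\,\Delta\,A)\to0$ for every measurable set $A$. *)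

theory Defs
  imports "HOL-Probability.Probability"
begin

definition lam :: "nat \<Rightarrow> real" where
  "lam d = 1 + cos (pi / real d)"

lemma lam_alt: "lam d = 2 * (cos (pi / (2 * real d)))\<^sup>2"
  using cos_double_cos[of "pi / (2 * real d)"] by (simp add: lam_def)

text \<open>For \<open>d \<ge> 2\<close> we have \<open>lam d \<ge> 1\<close>, so the first two branches of \<open>g\<close> are disjoint.\<close>

definition g :: "nat \<Rightarrow> real \<Rightarrow> real" where
  "g d y = (if lam d < y then y - lam d
            else if 0 < y \<and> y < 1/2 then y / (1 - 2 * y)
            else undefined)"

text \<open>
  The exchange of the \<open>d\<close> intervals \<open>[c (j - 1), c j[\<close>, \<open>1 \<le> j \<le> d\<close>, with permutation \<open>p\<close>:
  the \<open>j\<close>-th interval is translated to the \<open>p j\<close>-th position, its new left endpoint being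
  \<open>c 0\<close> plus the total length of the intervals \<open>i\<close> with \<open>p i < p j\<close>.
  Values outside \<open>[c 0, c d[\<close> are unspecified.
\<close>

definition iet_index :: "nat \<Rightarrow> (nat \<Rightarrow> real) \<Rightarrow> real \<Rightarrow> nat" where
  "iet_index d c x = (THE j. j \<in> {1..d} \<and> x \<in> {c (j - 1)..<c j})"

definition iet :: "nat \<Rightarrow> (nat \<Rightarrow> real) \<Rightarrow> (nat \<Rightarrow> nat) \<Rightarrow> real \<Rightarrow> real" where
  "iet d c p x =
     (let j = iet_index d c x
      in x - c (j - 1) + (c 0 + (\<Sum>i\<in>{i \<in> {1..d}. p i < p j}. c i - c (i - 1))))"

text \<open>The formula gives \<open>gam d \<theta> 0 = -1\<close> and \<open>gam d \<theta> d = 1\<close>, see below.\<close>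

definition gam :: "nat \<Rightarrow> real \<Rightarrow> nat \<Rightarrow> real" where
  "gam d \<theta> j = - cos (real j * pi / real d) + tan \<theta> * sin (real j * pi / real d)"

definition billiard_iet :: "nat \<Rightarrow> real \<Rightarrow> real \<Rightarrow> real" where
  "billiard_iet d \<theta> = iet d (gam d \<theta>) (\<lambda>j. d - j + 1)"

definition y_param :: "nat \<Rightarrow> real \<Rightarrow> real" where
  "y_param d \<theta> = (sin (pi / real d) / \<bar>tan \<theta>\<bar> - (1 + cos (pi / real d))) / 2"

definition measure_preserving_system :: "'a measure \<Rightarrow> ('a \<Rightarrow> 'a) \<Rightarrow> bool" where
  "measure_preserving_system M T \<longleftrightarrow>
     prob_space M \<and> T \<in> measurable M M \<and> distr M M T = M"

text \<open>
  The definition uses forward images, and is meant for maps sending measurable sets to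
  measurable sets; \<open>sets_image_billiard_iet\<close> below shows this for the maps considered here.
\<close>

definition rigid :: "'a measure \<Rightarrow> ('a \<Rightarrow> 'a) \<Rightarrow> bool" where
  "rigid M T \<longleftrightarrow> measure_preserving_system M T \<and>
     (\<exists>s :: nat \<Rightarrow> nat. filterlim s at_top sequentially \<and>
        (\<forall>A\<in>sets M. (\<lambda>n. measure M (sym_diff ((T ^^ s n) ` A) A)) \<longlonglongrightarrow> 0))"

definition normalized_lebesgue :: "real measure" where
  "normalized_lebesgue = uniform_measure (lebesgue_on {-1..<1}) {-1..<1}"

text \<open>\<open>N_sum m q k\<close> is \<open>N\<^sub>k\<close>; \<open>history m q n\<close> is \<open>[m 0, q 0, \<dots>, m (n - 1), q (n - 1)]\<close>.\<close>

definition N_sum :: "(nat \<Rightarrow> nat) \<Rightarrow> (nat \<Rightarrow> nat) \<Rightarrow> nat \<Rightarrow> nat" where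
  "N_sum m q k = (\<Sum>j\<le>k. m j + q j)"

definition history :: "(nat \<Rightarrow> nat) \<Rightarrow> (nat \<Rightarrow> nat) \<Rightarrow> nat \<Rightarrow> nat list" where
  "history m q n = concat (map (\<lambda>j. [m j, q j]) [0..<n])"

lemma space_normalized_lebesgue [simp]: "space normalized_lebesgue = {-1..<1}"
  by (simp add: normalized_lebesgue_def)

lemma sets_normalized_lebesgue: "sets normalized_lebesgue = sets (lebesgue_on {-1..<1})"
  by (simp add: normalized_lebesgue_def)

lemma prob_space_normalized_lebesgue: "prob_space normalized_lebesgue"
  unfolding normalized_lebesgue_def
  by (rule prob_space_uniform_measure) (simp_all add: emeasure_restrict_space)

lemma gam_0: "gam d \<theta> 0 = -1"
  by (simp add: gam_def)

lemma gam_d: "d > 0 \<Longrightarrow> gam d \<theta> d = 1"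
  by (simp add: gam_def)

lemma gam_less_Suc:
  assumes "d \<ge> 2" "\<bar>\<theta>\<bar> < pi / (2 * real d)" "j < d"
  shows "gam d \<theta> j < gam d \<theta> (Suc j)"
proof -
  define a where "a = pi / (2 * real d)"
  define b where "b = (2 * real j + 1) * a"
  have d: "real d \<ge> 2" using assms(1) by simp
  have a: "0 < a" "a \<le> pi / 4" using d by (auto simp: a_def field_simps)
  have th: "\<bar>\<theta>\<bar> < a" using assms(2) a_def by simp
  have j1: "real j * pi / real d = b - a" "real (Suc j) * pi / real d = b + a"
    using d by (auto simp: a_def b_def field_simps)
  have "a \<le> b" using a by (simp add: b_def algebra_simps)
  have "2 * real j + 1 \<le> 2 * real d - 1" using assms(3) by linarith
  hence "b \<le> (2 * real d - 1) * a" using a by (simp add: b_def)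
  also have "\<dots> = pi - a" using d by (simp add: a_def field_simps)
  finally have "b \<le> pi - a" .
  have s1: "sin (b + \<theta>) > 0"
    using \<open>a \<le> b\<close> \<open>b \<le> pi - a\<close> th by (intro sin_gt_zero) auto
  have s2: "sin a > 0" using a pi_gt_zero by (intro sin_gt_zero) linarith+
  have c: "cos \<theta> > 0" using th a pi_gt_zero by (intro cos_gt_zero_pi) linarith+
  have "gam d \<theta> (Suc j) - gam d \<theta> j = 2 * sin a * (sin b + tan \<theta> * cos b)"
    unfolding gam_def j1 by (simp add: cos_add cos_diff sin_add sin_diff algebra_simps)
  also have "\<dots> = 2 * sin a * sin (b + \<theta>) / cos \<theta>"
    using c by (simp add: sin_add tan_def field_simps)
  also have "\<dots> > 0" using s1 s2 c by simp
  finally show ?thesis by simp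
qed

lemma gam_mono:
  assumes "d \<ge> 2" "\<bar>\<theta>\<bar> < pi / (2 * real d)" "i \<le> j" "j \<le> d"
  shows "gam d \<theta> i \<le> gam d \<theta> j"
  using assms(3,4)
proof (induction j rule: dec_induct)
  case (step n)
  thus ?case using gam_less_Suc[OF assms(1,2), of n] by simp
qed simp

lemma ex_gam_interval:
  assumes "d \<ge> 2" "x \<in> {-1..<1}"
  shows "\<exists>j\<in>{1..d}. x \<in> {gam d \<theta> (j - 1)..<gam d \<theta> j}"
proof -
  define j where "j = (LEAST j. x < gam d \<theta> j)"
  have P: "x < gam d \<theta> d" using assms by (simp add: gam_d)
  have 1: "x < gam d \<theta> j" unfolding j_def by (rule LeastI[of _ d]) (rule P)
  have 2: "j \<le> d" unfolding j_def by (rule Least_le) (rule P)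
  have 3: "j \<noteq> 0" using 1 assms(2) by (cases "j = 0") (auto simp: gam_0)
  have "\<not> x < gam d \<theta> (j - 1)"
    using not_less_Least[of "j - 1" "\<lambda>j. x < gam d \<theta> j"] 3 unfolding j_def by simp
  thus ?thesis using 1 2 3 by (intro bexI[of _ j]) auto
qed

lemma iet_index_gam:
  assumes "d \<ge> 2" "\<bar>\<theta>\<bar> < pi / (2 * real d)"
    and j: "j \<in> {1..d}" "x \<in> {gam d \<theta> (j - 1)..<gam d \<theta> j}"
  shows "iet_index d (gam d \<theta>) x = j"
  unfolding iet_index_def
proof (rule the_equality)
  fix i assume i: "i \<in> {1..d} \<and> x \<in> {gam d \<theta> (i - 1)..<gam d \<theta> i}"
  have "\<not> i < j" using gam_mono[OF assms(1,2), of i "j - 1"] i j by force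
  moreover have "\<not> j < i" using gam_mono[OF assms(1,2), of j "i - 1"] i j by force
  ultimately show "i = j" by simp
qed (use j in auto)

text \<open>On its \<open>j\<close>-th interval the map is a translation onto \<open>[-gam d \<theta> j, -gam d \<theta> (j - 1)[\<close>.\<close>

lemma billiard_iet_eq:
  assumes "d \<ge> 2" "\<bar>\<theta>\<bar> < pi / (2 * real d)"
    and j: "j \<in> {1..d}" "x \<in> {gam d \<theta> (j - 1)..<gam d \<theta> j}"
  shows "billiard_iet d \<theta> x = x - gam d \<theta> (j - 1) - gam d \<theta> j"
proof -
  have "{i \<in> {1..d}. d - i + 1 < d - j + 1} = {Suc j..d}" using j by auto
  hence "(\<Sum>i\<in>{i \<in> {1..d}. d - i + 1 < d - j + 1}. gam d \<theta> i - gam d \<theta> (i - 1))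
         = (\<Sum>i\<in>{Suc j..d}. gam d \<theta> i - gam d \<theta> (i - 1))" by simp
  also have "\<dots> = gam d \<theta> d - gam d \<theta> j"
    using sum_telescope''[of j d "gam d \<theta>"] j by simp
  finally show ?thesis
    using assms(1) unfolding billiard_iet_def iet_def iet_index_gam[OF assms]
    by (simp add: Let_def gam_0 gam_d)
qed

lemma sets_image_billiard_iet:
  assumes "d \<ge> 2" "\<bar>\<theta>\<bar> < pi / (2 * real d)" "A \<in> sets normalized_lebesgue"
  shows "billiard_iet d \<theta> ` A \<in> sets normalized_lebesgue"
proof -
  let ?c = "gam d \<theta>"
  have A: "A \<in> sets lebesgue" "A \<subseteq> {-1..<1}"
    using assms(3) by (auto simp: sets_normalized_lebesgue sets_restrict_space_iff)
  define B where "B j = (\<lambda>x. (- ?c (j - 1) - ?c j) + x) ` (A \<inter> {?c (j - 1)..<?c j})" for j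
  have eq: "billiard_iet d \<theta> ` (A \<inter> {?c (j - 1)..<?c j}) = B j" if "j \<in> {1..d}" for j
    unfolding B_def
  proof (rule image_cong[OF refl])
    fix x assume "x \<in> A \<inter> {?c (j - 1)..<?c j}"
    thus "billiard_iet d \<theta> x = (- ?c (j - 1) - ?c j) + x"
      using billiard_iet_eq[OF assms(1,2) that, of x] by auto
  qed
  have "A = (\<Union>j\<in>{1..d}. A \<inter> {?c (j - 1)..<?c j})"
    using ex_gam_interval[OF assms(1), of _ \<theta>] A(2) by blast
  hence "billiard_iet d \<theta> ` A = billiard_iet d \<theta> ` (\<Union>j\<in>{1..d}. A \<inter> {?c (j - 1)..<?c j})"
    by (rule arg_cong)
  also have "\<dots> = (\<Union>j\<in>{1..d}. B j)" by (simp only: image_UN) (rule SUP_cong[OF refl], rule eq)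
  finally have img: "billiard_iet d \<theta> ` A = (\<Union>j\<in>{1..d}. B j)" .
  have "B j \<in> sets lebesgue" for j
    unfolding B_def using A(1) by (intro lebesgue_sets_translation) auto
  moreover have "B j \<subseteq> {-1..<1}" if j: "j \<in> {1..d}" for j
  proof -
    have "j - 1 \<le> d" "j \<le> d" using j by auto
    hence "-1 \<le> ?c (j - 1)" "?c j \<le> 1"
      using gam_mono[OF assms(1,2), of 0 "j - 1"] gam_mono[OF assms(1,2), of j d] assms(1)
      by (simp_all add: gam_0 gam_d)
    thus ?thesis by (auto simp: B_def)
  qed
  ultimately have "(\<Union>j\<in>{1..d}. B j) \<in> sets lebesgue \<and> (\<Union>j\<in>{1..d}. B j) \<subseteq> {-1..<1}"
    by (intro conjI UN_least sets.finite_UN) simp_all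
  thus ?thesis
    unfolding img by (simp add: sets_normalized_lebesgue sets_restrict_space_iff)
qed

end

theory Submission
  imports Defs
begin

text \<open>
  Put \<open>b = \<pi> / (2 d)\<close>. For \<open>t = tan \<theta> > 0\<close> every exchanged interval splits into a left part of length
  \<open>\<alpha> sin (2 k b)\<close> and a right part of length \<open>\<beta> sin ((2 k - 1) b)\<close>, where \<open>\<alpha> = 2 t\<close> and
  \<open>\<beta> = 2 (sin b - t cos b)\<close>; the left part of interval \<open>k\<close> is moved into interval \<open>d - k\<close>, the right part
  into interval \<open>d + 1 - k\<close>. This is the flow on a staircase surface whose two cylinder directions
  admit multitwists, namely \<open>\<beta> \<mapsto> \<beta> + 2 \<alpha> cos b\<close> and \<open>\<alpha> \<mapsto> \<alpha> + 2 \<beta> cos b\<close>. As \<open>y = cos b * \<beta> / \<alpha>\<close>, they act as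
  \<open>y \<mapsto> y + \<lambda>\<close> and \<open>y \<mapsto> y / (1 + 2 y)\<close>, the inverse branches of \<open>g\<close>, and they preserve the property that all
  orbits are periodic. At the cusps \<open>y = \<infinity>\<close> (\<open>\<alpha> = 0\<close>) and \<open>y = 0\<close> (\<open>\<beta> = 0\<close>) the map is an involution, so it
  is pointwise periodic at every image of a cusp under these branches. For a fixed history, a large
  \<open>m\<^sub>n\<close> (or \<open>q\<^sub>n\<close>) forces \<open>y\<close> to be close to such an image; by continuity in \<open>\<theta>\<close> some high power of \<open>\<I>\<close>
  is then close to the identity off a small set. Negative \<open>\<theta>\<close> are covered because changing the sign of
  \<open>\<theta>\<close> replaces \<open>\<I>\<close> by its inverse.
\<close>

section \<open>Periodicity on the staircase surface\<close>

definition periodic_pt :: "('a \<Rightarrow> 'a) \<Rightarrow> 'a \<Rightarrow> bool" where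
  "periodic_pt T x \<longleftrightarrow> (\<exists>n>0. (T ^^ n) x = x)"

lemma periodic_pt_funpow:
  assumes "periodic_pt T x"
  shows "periodic_pt T ((T ^^ i) x)"
proof -
  obtain n where n: "n > 0" "(T ^^ n) x = x" using assms by (auto simp: periodic_pt_def)
  have "(T ^^ n) ((T ^^ i) x) = (T ^^ i) ((T ^^ n) x)"
    by (simp add: add.commute flip: funpow_add[unfolded o_def, THEN fun_cong] )
  thus ?thesis using n by (auto simp: periodic_pt_def)
qed

text \<open>Periodicity passes from \<open>T\<close> to \<open>T'\<close> when \<open>T\<close>
  records some returns, not necessarily the first ones, of \<open>T'\<close> to the lifted set:
  periods lift, and every point of \<open>S'\<close> lies on the forward orbit of a lifted
  point.\<close>

lemma periodic_pt_induced:
  assumes S: "\<And>p. p \<in> S \<Longrightarrow> T p \<in> S"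
    and ret: "\<And>p. p \<in> S \<Longrightarrow> \<exists>n>0. (T' ^^ n) (\<iota> p) = \<iota> (T p)"
    and cover: "\<And>x. x \<in> S' \<Longrightarrow> \<exists>p\<in>S. \<exists>i. x = (T' ^^ i) (\<iota> p)"
    and per: "\<And>p. p \<in> S \<Longrightarrow> periodic_pt T p"
    and x: "x \<in> S'"
  shows "periodic_pt T' x"
proof -
  \<comment> \<open>The bound \<open>N \<ge> n\<close> keeps the lifted period positive.\<close>
  have it: "(T ^^ n) p \<in> S \<and> (\<exists>N\<ge>n. (T' ^^ N) (\<iota> p) = \<iota> ((T ^^ n) p))" if "p \<in> S" for n p
  proof (induction n)
    case 0 thus ?case using that by (intro conjI exI[of _ 0]) auto
  next
    case (Suc n)
    then obtain N where N: "N \<ge> n" "(T' ^^ N) (\<iota> p) = \<iota> ((T ^^ n) p)" by blast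
    obtain k where k: "k > 0" "(T' ^^ k) (\<iota> ((T ^^ n) p)) = \<iota> (T ((T ^^ n) p))"
      using ret[of "(T ^^ n) p"] Suc by blast
    have "(T' ^^ (k + N)) (\<iota> p) = \<iota> ((T ^^ Suc n) p)"
      using N k by (simp add: funpow_add)
    moreover have "k + N \<ge> Suc n" using N k by simp
    ultimately show ?case using Suc S by auto
  qed
  obtain p i where p: "p \<in> S" "x = (T' ^^ i) (\<iota> p)" using cover[OF x] by blast
  obtain n where n: "n > 0" "(T ^^ n) p = p" using per[OF p(1)] by (auto simp: periodic_pt_def)
  obtain N where "N \<ge> n" "(T' ^^ N) (\<iota> p) = \<iota> p" using it[OF p(1), of n] n by auto
  hence "periodic_pt T' (\<iota> p)" using n by (auto simp: periodic_pt_def intro!: exI[of _ N])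
  thus ?thesis unfolding p(2) by (rule periodic_pt_funpow)
qed

section \<open>Lengths of the left and right parts and their twist relations\<close>

locale regular_polygon =
  fixes d :: nat
  assumes d2: "d \<ge> 2"
begin

definition b :: real where "b = pi / (2 * real d)"

lemma b_pos: "b > 0" using d2 by (simp add: b_def)

lemma two_d_b: "2 * real d * b = pi" using d2 by (simp add: b_def)

lemma b_le: "b \<le> pi / 4"
proof -
  have "real d \<ge> 2" using d2 by simp
  thus ?thesis by (simp add: b_def field_simps)
qed

lemma cos_b_pos: "cos b > 0"
  using b_pos b_le pi_gt_zero by (intro cos_gt_zero_pi) linarith+

lemma sin_b_pos: "sin b > 0"
  using b_pos b_le pi_gt_zero by (intro sin_gt_zero) linarith+

definition hh :: "real \<Rightarrow> nat \<Rightarrow> real" where "hh \<alpha> k = \<alpha> * sin (2 * real k * b)"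
definition vv :: "real \<Rightarrow> nat \<Rightarrow> real" where "vv \<beta> k = \<beta> * sin ((2 * real k - 1) * b)"

lemma hh_nonneg: "\<alpha> \<ge> 0 \<Longrightarrow> k \<le> d \<Longrightarrow> hh \<alpha> k \<ge> 0"
proof -
  assume "\<alpha> \<ge> 0" "k \<le> d"
  have "2 * real k * b \<le> 2 * real d * b" using \<open>k \<le> d\<close> b_pos by simp
  hence "sin (2 * real k * b) \<ge> 0" using b_pos two_d_b by (intro sin_ge_zero) auto
  thus ?thesis using \<open>\<alpha> \<ge> 0\<close> by (simp add: hh_def)
qed

lemma sin_odd_b_pos:
  assumes "1 \<le> k" "k \<le> d"
  shows "sin ((2 * real k - 1) * b) > 0"
proof -
  have "real k \<ge> 1" using assms by simp
  hence "(2 * real k - 1) * b > 0" using b_pos by simp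
  moreover have "real k * b \<le> real d * b" using assms b_pos by (intro mult_right_mono) auto
  moreover have "(2 * real k - 1) * b = 2 * (real k * b) - b" by (simp add: algebra_simps)
  ultimately have "(2 * real k - 1) * b > 0" "(2 * real k - 1) * b < pi"
    using two_d_b b_pos by linarith+
  thus ?thesis by (intro sin_gt_zero)
qed

lemma vv_nonneg: "\<beta> \<ge> 0 \<Longrightarrow> 1 \<le> k \<Longrightarrow> k \<le> d \<Longrightarrow> vv \<beta> k \<ge> 0"
  using sin_odd_b_pos[of k] by (simp add: vv_def)

lemma hh_d [simp]: "hh \<alpha> d = 0"
  using two_d_b by (simp add: hh_def)

lemma hh_reflect: "k \<le> d \<Longrightarrow> hh \<alpha> (d - k) = hh \<alpha> k"
proof -
  assume "k \<le> d"
  hence "2 * real (d - k) * b = pi - 2 * real k * b"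
    using two_d_b by (simp add: of_nat_diff algebra_simps)
  thus ?thesis by (simp add: hh_def)
qed

lemma vv_reflect: "k \<le> d \<Longrightarrow> vv \<beta> (d - k) = vv \<beta> (k + 1)"
proof -
  assume "k \<le> d"
  hence "(2 * real (d - k) - 1) * b = pi - (2 * real (k + 1) - 1) * b"
    using two_d_b by (simp add: of_nat_diff algebra_simps)
  thus ?thesis by (simp add: vv_def)
qed

lemma hh_reflect': "1 \<le> k \<Longrightarrow> k \<le> d \<Longrightarrow> hh \<alpha> (d + 1 - k) = hh \<alpha> (k - 1)"
  using hh_reflect[of "k - 1" \<alpha>] by (simp add: Suc_diff_le)

lemma vv_reflect': "1 \<le> k \<Longrightarrow> k \<le> d \<Longrightarrow> vv \<beta> (d + 1 - k) = vv \<beta> k"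
  using vv_reflect[of "k - 1" \<beta>] by (simp add: Suc_diff_le)

text \<open>Values of the sine at distance \<open>b\<close> on both sides of a point add up to
  \<open>2 * cos b\<close> times the middle value. Hence one factor \<open>2 * cos b\<close> adds
  exactly one full turn, of length \<open>hh \<alpha> k + hh \<alpha> (k - 1)\<close>, in every
  vertical cylinder at once.\<close>

lemma vv_twist:
  assumes "1 \<le> k"
  shows "vv (\<beta> + 2 * cos b * \<alpha>) k = vv \<beta> k + hh \<alpha> k + hh \<alpha> (k - 1)"
proof -
  have "2 * real k * b = (2 * real k - 1) * b + b" "2 * real (k - 1) * b = (2 * real k - 1) * b - b"
    using assms by (auto simp: of_nat_diff algebra_simps)
  thus ?thesis unfolding hh_def vv_def by (simp only: sin_add sin_diff) (simp add: algebra_simps)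
qed

text \<open>The same identity centred at an even multiple of \<open>b\<close>;
  \<open>vv \<beta> k + vv \<beta> (k + 1)\<close> is a full turn in a horizontal cylinder.\<close>

lemma hh_twist: "hh (\<alpha> + 2 * cos b * \<beta>) k = hh \<alpha> k + vv \<beta> k + vv \<beta> (k + 1)"
proof -
  have "(2 * real (k + 1) - 1) * b = 2 * real k * b + b" "(2 * real k - 1) * b = 2 * real k * b - b"
    by (auto simp: algebra_simps)
  thus ?thesis unfolding hh_def vv_def by (simp only: sin_add sin_diff) (simp add: algebra_simps)
qed

section \<open>The staircase map, its periodic cusps and the two multitwists\<close>

definition states :: "real \<Rightarrow> real \<Rightarrow> (nat \<times> real) set" where
  "states \<alpha> \<beta> = {(k, u). 1 \<le> k \<and> k \<le> d \<and> 0 \<le> u \<and> u < vv \<beta> k + hh \<alpha> k}"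

text \<open>The state \<open>(k, u)\<close> is the point at distance \<open>u\<close> (up to scale) from the left end of the
  \<open>k\<close>-th exchanged interval. The branch \<open>u < hh \<alpha> k\<close> never occurs for \<open>k = d\<close>, as \<open>hh \<alpha> d = 0\<close>.\<close>

definition stair :: "real \<Rightarrow> real \<Rightarrow> nat \<times> real \<Rightarrow> nat \<times> real" where
  "stair \<alpha> \<beta> = (\<lambda>(k, u). if u < hh \<alpha> k then (d - k, u + vv \<beta> (d - k)) else (d + 1 - k, u - hh \<alpha> k))"

lemma stair_in_states:
  assumes "\<alpha> \<ge> 0" "\<beta> \<ge> 0" "p \<in> states \<alpha> \<beta>"
  shows "stair \<alpha> \<beta> p \<in> states \<alpha> \<beta>"
proof -
  obtain k u where p: "p = (k, u)" by force
  have k: "1 \<le> k" "k \<le> d" "0 \<le> u" "u < vv \<beta> k + hh \<alpha> k" using assms(3) by (auto simp: p states_def)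
  show ?thesis
  proof (cases "u < hh \<alpha> k")
    case True
    hence "k \<noteq> d" using k by auto
    thus ?thesis using True k assms vv_nonneg[of \<beta> "d - k"]
      by (simp add: p states_def stair_def hh_reflect)
  next
    case False
    have "hh \<alpha> (d + 1 - k) \<ge> 0" by (rule hh_nonneg) (use assms k in auto)
    moreover have "1 \<le> d + 1 - k" "d + 1 - k \<le> d" using k by auto
    ultimately show ?thesis using False k assms vv_reflect'[of k \<beta>]
      by (simp add: p states_def stair_def)
  qed
qed

definition all_periodic :: "real \<Rightarrow> real \<Rightarrow> bool" where
  "all_periodic \<alpha> \<beta> \<longleftrightarrow> (\<forall>p\<in>states \<alpha> \<beta>. periodic_pt (stair \<alpha> \<beta>) p)"

text \<open>For \<alpha> = 0 only the second branch of \<open>stair\<close> occurs, and it is the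
  reflection \<open>k \<mapsto> d + 1 - k\<close> with \<open>u\<close> unchanged.\<close>

lemma all_periodic_0_1: "all_periodic 0 1"
proof -
  have "(stair 0 1 ^^ 2) p = p" if "p \<in> states 0 1" for p
    using that by (auto simp: states_def stair_def hh_def numeral_2_eq_2)
  thus ?thesis by (auto simp: all_periodic_def periodic_pt_def intro!: exI[of _ 2])
qed

text \<open>For \<beta> = 0 every state uses the first branch, the reflection
  \<open>k \<mapsto> d - k\<close> with \<open>u\<close> unchanged.\<close>

lemma all_periodic_1_0: "all_periodic 1 0"
proof -
  have "(stair 1 0 ^^ 2) p = p" if "p \<in> states 1 0" for p
    using that hh_reflect[of "fst p" 1] by (auto simp: states_def stair_def vv_def numeral_2_eq_2)
  thus ?thesis by (auto simp: all_periodic_def periodic_pt_def intro!: exI[of _ 2])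
qed

text \<open>A full turn in each vertical cylinder: \<open>\<iota>\<close> lifts a state of the untwisted system to the
  point two vertical steps before it, and \<open>T'\<close> follows \<open>T\<close> up to those steps.\<close>

lemma all_periodic_vertical:
  assumes ab: "\<alpha> \<ge> 0" "\<beta> \<ge> 0" and per: "all_periodic \<alpha> \<beta>"
  shows "all_periodic \<alpha> (\<beta> + 2 * cos b * \<alpha>)"
proof -
  define T where "T = stair \<alpha> \<beta>"
  define \<beta>' where "\<beta>' = \<beta> + 2 * cos b * \<alpha>"
  define T' where "T' = stair \<alpha> \<beta>'"
  define \<iota> where "\<iota> = (\<lambda>(k, u). (k :: nat, u + hh \<alpha> k + hh \<alpha> (k - 1)))"
  have V: "T' (k, u) = (d + 1 - k, u - hh \<alpha> k)" if "u \<ge> hh \<alpha> k" for k u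
    using that by (simp add: T'_def stair_def)
  have H: "T' (k, u) = (d - k, u + vv \<beta>' (d - k))" if "u < hh \<alpha> k" for k u
    using that by (simp add: T'_def stair_def)
  have one: "T' (\<iota> (k, u)) = (d + 1 - k, u + hh \<alpha> (k - 1))" if "1 \<le> k" "k \<le> d" "0 \<le> u" for k u
    using that ab hh_nonneg[of \<alpha> "k - 1"] V[of k "u + hh \<alpha> k + hh \<alpha> (k - 1)"] by (simp add: \<iota>_def)
  \<comment> \<open>Two vertical steps return to index \<open>k\<close> and lower \<open>u\<close>
    by the circumference \<open>hh \<alpha> k + hh \<alpha> (k - 1)\<close>, which undoes
    \<open>\<iota>\<close>.\<close>
  have two: "T' (T' (\<iota> (k, u))) = (k, u)" if "1 \<le> k" "k \<le> d" "0 \<le> u" for k u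
    using that hh_reflect'[of k \<alpha>] V[of "d + 1 - k" "u + hh \<alpha> (k - 1)"] by (simp only: one) simp
  have "periodic_pt T' x" if "x \<in> states \<alpha> \<beta>'" for x
  proof (rule periodic_pt_induced[where T = T and S = "states \<alpha> \<beta>" and \<iota> = \<iota>])
    show "T p \<in> states \<alpha> \<beta>" if "p \<in> states \<alpha> \<beta>" for p
      using stair_in_states[OF ab that] by (simp add: T_def)
    show "periodic_pt T p" if "p \<in> states \<alpha> \<beta>" for p
      using per that by (simp add: T_def all_periodic_def)
    show "x \<in> states \<alpha> \<beta>'" by fact
    show "\<exists>n>0. (T' ^^ n) (\<iota> p) = \<iota> (T p)" if p: "p \<in> states \<alpha> \<beta>" for p
    proof -
      obtain k u where pk: "p = (k, u)" by force
      have k: "1 \<le> k" "k \<le> d" "0 \<le> u" using p by (auto simp: pk states_def)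
      show ?thesis
      proof (cases "u < hh \<alpha> k")
        case True
        hence "k \<noteq> d" using k by auto
        \<comment> \<open>After the turn, the horizontal step of \<open>T'\<close> overshoots that
          of \<open>T\<close> by the added length, which is the shift made by
          \<open>\<iota>\<close>.\<close>
        have "(T' ^^ 3) (\<iota> p) = (d - k, u + vv \<beta>' (d - k))"
          using k True by (simp add: numeral_3_eq_3 pk two H)
        also have "\<dots> = \<iota> (T p)"
          using True vv_twist[of "d - k" \<beta> \<alpha>] \<open>k \<noteq> d\<close> k by (simp add: \<iota>_def T_def stair_def pk \<beta>'_def)
        finally show ?thesis by (intro exI[of _ 3]) simp
      next
        case False
        \<comment> \<open>On a vertical step the lift intertwines \<open>T\<close> and
          \<open>T'\<close> directly; the extra turn stays pending.\<close>
        have "\<iota> (T p) = (d + 1 - k, u + hh \<alpha> (k - 1))"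
          using False hh_reflect'[of k \<alpha>] hh_reflect[of k \<alpha>] k by (simp add: \<iota>_def T_def stair_def pk)
        thus ?thesis using one[OF k] by (intro exI[of _ 1]) (simp add: pk)
      qed
    qed
    show "\<exists>p\<in>states \<alpha> \<beta>. \<exists>i. x = (T' ^^ i) (\<iota> p)" if x: "x \<in> states \<alpha> \<beta>'" for x
    proof -
      obtain k u where xk: "x = (k, u)" by force
      have k: "1 \<le> k" "k \<le> d" "0 \<le> u" using x by (auto simp: xk states_def)
      have u: "u < vv \<beta> k + 2 * hh \<alpha> k + hh \<alpha> (k - 1)"
        using x vv_twist[of k \<beta> \<alpha>] k by (simp add: xk states_def \<beta>'_def)
      \<comment> \<open>These ranges are reached from lifted points after 0, 2 and 1 steps. The
        third one is the gap that the others leave if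
        \<open>vv \<beta> k < hh \<alpha> (k - 1)\<close>.\<close>
      consider "u \<ge> hh \<alpha> k + hh \<alpha> (k - 1)" | "u < vv \<beta> k + hh \<alpha> k"
        | "vv \<beta> k + hh \<alpha> k \<le> u" "u < hh \<alpha> k + hh \<alpha> (k - 1)" by linarith
      thus ?thesis
      proof cases
        case 1
        define p where "p = (k, u - hh \<alpha> k - hh \<alpha> (k - 1))"
        have "p \<in> states \<alpha> \<beta>" using 1 k u by (simp add: p_def states_def)
        moreover have "x = (T' ^^ 0) (\<iota> p)" by (simp add: xk p_def \<iota>_def)
        ultimately show ?thesis by blast
      next
        case 2
        have "x \<in> states \<alpha> \<beta>" using 2 k by (simp add: xk states_def)
        moreover have "x = (T' ^^ 2) (\<iota> x)" using two[OF k] by (simp add: xk numeral_2_eq_2)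
        ultimately show ?thesis by blast
      next
        case 3
        define p where "p = (d + 1 - k, u - hh \<alpha> k)"
        have v: "vv \<beta> k \<ge> 0" using vv_nonneg ab k by simp
        have "1 \<le> d + 1 - k" "d + 1 - k \<le> d" using k by auto
        hence "p \<in> states \<alpha> \<beta>" using 3 k v hh_reflect'[of k \<alpha>] vv_reflect'[of k \<beta>]
          by (simp add: p_def states_def)
        moreover have "x = (T' ^^ 1) (\<iota> p)"
          using one[of "d + 1 - k" "u - hh \<alpha> k"] 3 k v hh_reflect[of k \<alpha>]
          by (simp add: xk p_def)
        ultimately show ?thesis by blast
      qed
    qed
  qed
  thus ?thesis by (simp add: all_periodic_def T'_def \<beta>'_def)
qed

text \<open>Analogue of the vertical case without a shift: horizontal steps increase
  \<open>u\<close>, so \<open>T'\<close> starts at the same state and inserts a full turn of two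
  horizontal steps before each vertical step with \<open>k < d\<close>.\<close>

lemma all_periodic_horizontal:
  assumes ab: "\<alpha> \<ge> 0" "\<beta> \<ge> 0" and per: "all_periodic \<alpha> \<beta>"
  shows "all_periodic (\<alpha> + 2 * cos b * \<beta>) \<beta>"
proof -
  define T where "T = stair \<alpha> \<beta>"
  define \<alpha>' where "\<alpha>' = \<alpha> + 2 * cos b * \<beta>"
  define T' where "T' = stair \<alpha>' \<beta>"
  have h': "hh \<alpha>' k = hh \<alpha> k + vv \<beta> k + vv \<beta> (k + 1)" for k
    unfolding \<alpha>'_def by (rule hh_twist)
  have V: "T' (k, u) = (d + 1 - k, u - hh \<alpha>' k)" if "u \<ge> hh \<alpha>' k" for k u
    using that by (simp add: T'_def stair_def)
  have one: "T' (k, u) = (d - k, u + vv \<beta> (k + 1))" if "k < d" "u < hh \<alpha>' k" for k u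
    using that vv_reflect[of k \<beta>] by (simp add: T'_def stair_def)
  have two: "T' (T' (k, u)) = (k, u + vv \<beta> k + vv \<beta> (k + 1))"
    if "1 \<le> k" "k < d" "0 \<le> u" "u < vv \<beta> k + hh \<alpha> k" for k u
  proof -
    have v: "vv \<beta> (k + 1) \<ge> 0" by (rule vv_nonneg) (use ab that in auto)
    have "T' (k, u) = (d - k, u + vv \<beta> (k + 1))" using that v by (intro one) (auto simp: h')
    also have "T' \<dots> = (k, u + vv \<beta> (k + 1) + vv \<beta> (d - k + 1))"
      using one[of "d - k" "u + vv \<beta> (k + 1)"] that hh_reflect[of k \<alpha>'] by (simp add: h')
    also have "vv \<beta> (d - k + 1) = vv \<beta> k" using vv_reflect'[of k \<beta>] that by (simp add: Suc_diff_le)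
    finally show ?thesis by simp
  qed
  have "periodic_pt T' x" if "x \<in> states \<alpha>' \<beta>" for x
  proof (rule periodic_pt_induced[where T = T and S = "states \<alpha> \<beta>" and \<iota> = "\<lambda>p. p"])
    show "T p \<in> states \<alpha> \<beta>" if "p \<in> states \<alpha> \<beta>" for p
      using stair_in_states[OF ab that] by (simp add: T_def)
    show "periodic_pt T p" if "p \<in> states \<alpha> \<beta>" for p
      using per that by (simp add: T_def all_periodic_def)
    show "x \<in> states \<alpha>' \<beta>" by fact
    show "\<exists>n>0. (T' ^^ n) p = T p" if p: "p \<in> states \<alpha> \<beta>" for p
    proof -
      obtain k u where pk: "p = (k, u)" by force
      have k: "1 \<le> k" "k \<le> d" "0 \<le> u" "u < vv \<beta> k + hh \<alpha> k" using p by (auto simp: pk states_def)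
      \<comment> \<open>Index \<open>d\<close> carries no horizontal cylinder, as \<open>hh\<close>
        vanishes there for both parameters.\<close>
      consider "k = d" | "k < d" "u < hh \<alpha> k" | "k < d" "u \<ge> hh \<alpha> k" using k by linarith
      thus ?thesis
      proof cases
        case 1
        hence "T' p = T p" using k by (simp add: pk T_def T'_def stair_def)
        thus ?thesis by (intro exI[of _ 1]) simp
      next
        case 2
        have "vv \<beta> (k + 1) \<ge> 0" "vv \<beta> k \<ge> 0" by (rule vv_nonneg; use ab 2 k in auto)+
        hence "T' p = T p" using 2 one[of k u] vv_reflect[of k \<beta>] by (simp add: h' pk T_def stair_def)
        thus ?thesis by (intro exI[of _ 1]) simp
      next
        case 3
        have "(T' ^^ 3) p = T p"
          using k 3 two[of k u] V[of k "u + vv \<beta> k + vv \<beta> (k + 1)"]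
          by (simp add: pk numeral_3_eq_3 h' T_def stair_def)
        thus ?thesis by (intro exI[of _ 3]) simp
      qed
    qed
    show "\<exists>p\<in>states \<alpha> \<beta>. \<exists>i. x = (T' ^^ i) p" if x: "x \<in> states \<alpha>' \<beta>" for x
    proof -
      obtain k u where xk: "x = (k, u)" by force
      have k: "1 \<le> k" "k \<le> d" "0 \<le> u" and u: "u < vv \<beta> k + hh \<alpha>' k" using x by (auto simp: xk states_def)
      show ?thesis
      proof (cases "u < vv \<beta> k + hh \<alpha> k")
        case True
        hence "x \<in> states \<alpha> \<beta>" using k by (simp add: xk states_def)
        moreover have "x = (T' ^^ 0) x" by simp
        ultimately show ?thesis by blast
      next
        case u2: False
        hence kd: "k < d" using k u by (cases "k = d") auto
        show ?thesis
        proof (cases "u \<ge> vv \<beta> k + vv \<beta> (k + 1)")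
          case True
          define p where "p = (k, u - vv \<beta> k - vv \<beta> (k + 1))"
          have "p \<in> states \<alpha> \<beta>" using True k u by (simp add: p_def states_def h')
          moreover have "x = (T' ^^ 2) p"
            using two[of k "u - vv \<beta> k - vv \<beta> (k + 1)"] True u k kd
            by (simp add: xk p_def numeral_2_eq_2 h')
          ultimately show ?thesis by blast
        next
          case False
          \<comment> \<open>The state lies beyond the old range but within one turn; half a turn
            back there is an old state.\<close>
          define p where "p = (d - k, u - vv \<beta> k)"
          have h: "hh \<alpha> k \<ge> 0" "vv \<beta> k \<ge> 0"  using hh_nonneg vv_nonneg ab k by auto
          have v: "vv \<beta> (d - k + 1) = vv \<beta> k" using vv_reflect'[of k \<beta>] k by (simp add: Suc_diff_le)
          have "p \<in> states \<alpha> \<beta>"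
            using False u2 k kd h hh_reflect[of k \<alpha>] vv_reflect[of k \<beta>]
            by (simp add: p_def states_def)
          moreover have "x = (T' ^^ 1) p"
            using one[of "d - k" "u - vv \<beta> k"] False u2 k kd h v hh_reflect[of k \<alpha>']
            by (simp add: xk p_def h')
          ultimately show ?thesis by blast
        qed
      qed
    qed
  qed
  thus ?thesis by (simp add: all_periodic_def T'_def \<alpha>'_def)
qed

section \<open>The interval exchange\<close>

abbreviation gm :: "real \<Rightarrow> nat \<Rightarrow> real" where "gm t \<equiv> gam d (arctan t)"

text \<open>Unlike \<^const>\<open>billiard_iet\<close>, this also covers the limits \<open>t = 0\<close> and \<open>t = \<plusminus> tan b\<close>,
  the latter with an empty interval.\<close>

definition exch :: "real \<Rightarrow> real \<Rightarrow> real" where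
  "exch t x = (let j = (LEAST j. x < gm t j) in x - gm t (j - 1) - gm t j)"

lemma gm_eq: "gm t j = - cos (2 * real j * b) + t * sin (2 * real j * b)"
proof -
  have "real j * pi / real d = 2 * real j * b" by (simp add: b_def)
  thus ?thesis by (simp only: gam_def tan_arctan)
qed

text \<open>These are the discontinuities of the inverse exchange, which is why \<open>- t\<close>
  will parametrize the inverse.\<close>

lemma gm_reflect:
  assumes "j \<le> d"
  shows "gm (- t) j = - gm t (d - j)"
proof -
  have "2 * real (d - j) * b = pi - 2 * real j * b"
    using two_d_b assms by (simp add: of_nat_diff algebra_simps)
  thus ?thesis unfolding gm_eq by simp
qed

text \<open>Expanding around the odd multiple \<open>e\<close> of \<open>b\<close> exhibits the
  right and left parts of the interval, with \<alpha> = \<open>2 * t\<close> and \<beta> =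
  \<open>2 * (sin b - t * cos b)\<close>.\<close>

lemma gm_step:
  assumes "1 \<le> j"
  shows "gm t j - gm t (j - 1) = vv (2 * (sin b - t * cos b)) j + hh (2 * t) j"
proof -
  define e where "e = (2 * real j - 1) * b"
  have "2 * real j * b = e + b" "2 * real (j - 1) * b = e - b"
    using assms by (auto simp: e_def of_nat_diff algebra_simps)
  thus ?thesis unfolding gm_eq hh_def vv_def e_def[symmetric]
    by (simp only: sin_add sin_diff cos_add cos_diff) (simp add: algebra_simps)
qed

text \<open>For \<open>t \<ge> 0\<close> the bound \<open>t \<le> tan b\<close> says that \<beta> is
  nonnegative, so both parts have nonnegative length; \<open>gm_reflect\<close> transfers this to
  negative \<open>t\<close>.\<close>

lemma gm_mono_Suc:
  assumes t: "\<bar>t\<bar> \<le> tan b" and j: "j < d"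
  shows "gm t j \<le> gm t (Suc j)"
proof -
  have pos: "gm t j \<le> gm t (Suc j)" if "0 \<le> t" "t \<le> tan b" "j < d" for t j
  proof -
    have "sin b - t * cos b \<ge> 0" using that cos_b_pos by (simp add: tan_def field_simps)
    thus ?thesis using gm_step[of "Suc j" t] vv_nonneg[of "2 * (sin b - t * cos b)" "Suc j"]
        hh_nonneg[of "2 * t" "Suc j"] that by simp
  qed
  show ?thesis
  proof (cases "t \<ge> 0")
    case True thus ?thesis using pos assms by simp
  next
    case False
    have "gm (- t) (d - Suc j) \<le> gm (- t) (Suc (d - Suc j))"
      by (rule pos) (use False t j in auto)
    thus ?thesis using gm_reflect[of "Suc j" t] gm_reflect[of j t] gm_reflect[of "d - j" t] gm_reflect[of "d - Suc j" t] j
      by (simp add: Suc_diff_Suc)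
  qed
qed

lemma gm_mono:
  assumes "\<bar>t\<bar> \<le> tan b" "i \<le> j" "j \<le> d"
  shows "gm t i \<le> gm t j"
  using assms(2,3)
proof (induction j rule: dec_induct)
  case (step n) thus ?case using gm_mono_Suc[OF assms(1), of n] by simp
qed simp

lemma gm_0: "gm t 0 = -1" and gm_d: "gm t d = 1"
  using d2 by (simp_all add: gam_0 gam_d)

lemma ex_gm_interval:
  assumes "x \<in> {-1..<1}"
  obtains j where "j \<in> {1..d}" "x \<in> {gm t (j - 1)..<gm t j}"
  using ex_gam_interval[OF d2 assms, of "arctan t"] by blast

lemma exch_eq:
  assumes "\<bar>t\<bar> \<le> tan b" "j \<in> {1..d}" "x \<in> {gm t (j - 1)..<gm t j}"
  shows "exch t x = x - gm t (j - 1) - gm t j"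
proof -
  have "(LEAST j. x < gm t j) = j"
  proof (rule Least_equality)
    show "x < gm t j" using assms by simp
    show "j \<le> i" if "x < gm t i" for i
    proof (rule ccontr)
      assume "\<not> j \<le> i"
      hence "gm t i \<le> gm t (j - 1)" using assms(2) by (intro gm_mono[OF assms(1)]) auto
      thus False using that assms(3) by simp
    qed
  qed
  thus ?thesis by (simp add: exch_def)
qed

lemma exch_interval:
  assumes "\<bar>t\<bar> \<le> tan b" "j \<in> {1..d}" "x \<in> {gm t (j - 1)..<gm t j}"
  shows "exch t x \<in> {gm (- t) (d - j)..<gm (- t) (d - j + 1)}"
proof -
  have "d - (d - j + 1) = j - 1" "d - j + 1 \<le> d" using assms(2) by auto
  thus ?thesis
    using assms gm_reflect[of "d - j" t] gm_reflect[of "d - j + 1" t] by (simp add: exch_eq)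
qed

lemma gm_bounds:
  assumes "\<bar>t\<bar> \<le> tan b" "j \<le> d"
  shows "-1 \<le> gm t j" "gm t j \<le> 1"
  using gm_mono[OF assms(1), of 0 j] gm_mono[OF assms(1), of j d] assms(2) by (simp_all add: gm_0 gm_d)

lemma exch_in:
  assumes "\<bar>t\<bar> \<le> tan b" "x \<in> {-1..<1}"
  shows "exch t x \<in> {-1..<1}"
proof -
  obtain j where j: "j \<in> {1..d}" "x \<in> {gm t (j - 1)..<gm t j}" by (rule ex_gm_interval[OF assms(2)])
  have "d - j \<le> d" "d - j + 1 \<le> d" using j by auto
  thus ?thesis using exch_interval[OF assms(1) j] gm_bounds[of "- t" "d - j"] gm_bounds[of "- t" "d - j + 1"] assms(1)
    by simp
qed

text \<open>Interval \<open>j\<close> for \<open>t\<close> lands on interval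
  \<open>d - j + 1\<close> for \<open>- t\<close>, where the opposite translation is
  applied.\<close>

lemma exch_uminus:
  assumes "\<bar>t\<bar> \<le> tan b" "x \<in> {-1..<1}"
  shows "exch (- t) (exch t x) = x"
proof -
  obtain j where j: "j \<in> {1..d}" "x \<in> {gm t (j - 1)..<gm t j}" by (rule ex_gm_interval[OF assms(2)])
  have j': "d - j + 1 \<in> {1..d}" "d - (d - j + 1) = j - 1" "d - (d - j) = j" using j by auto
  have "exch (- t) (exch t x) = exch t x - gm (- t) (d - j) - gm (- t) (d - j + 1)"
    using exch_eq[OF _ j'(1), of "- t" "exch t x"] exch_interval[OF assms(1) j] assms(1) by simp
  thus ?thesis using exch_eq[OF assms(1) j] gm_reflect[of "d - j" t] gm_reflect[of "d - j + 1" t] j' by simp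
qed

lemma exch_funpow_in:
  assumes "\<bar>t\<bar> \<le> tan b" "x \<in> {-1..<1}"
  shows "(exch t ^^ n) x \<in> {-1..<1}"
  using exch_in[OF assms(1)] assms(2) by (induction n) auto

lemma exch_funpow_uminus:
  assumes "\<bar>t\<bar> \<le> tan b" "x \<in> {-1..<1}"
  shows "(exch (- t) ^^ n) ((exch t ^^ n) x) = x"
proof (induction n)
  case (Suc n)
  have "(exch (- t) ^^ Suc n) ((exch t ^^ Suc n) x)
      = (exch (- t) ^^ n) (exch (- t) (exch t ((exch t ^^ n) x)))"
    by (simp add: funpow_swap1)
  also have "\<dots> = x" using Suc exch_uminus[OF assms(1) exch_funpow_in[OF assms]] by simp
  finally show ?case .
qed simp

lemma inj_on_exch_funpow: "\<bar>t\<bar> \<le> tan b \<Longrightarrow> inj_on (exch t ^^ n) {-1..<1}"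
  by (rule inj_on_inverseI[of _ "exch (- t) ^^ n"]) (rule exch_funpow_uminus)

lemma inj_on_exch: "\<bar>t\<bar> \<le> tan b \<Longrightarrow> inj_on (exch t) {-1..<1}"
  using inj_on_exch_funpow[of t 1] by simp

lemma abs_tan_le:
  assumes "\<bar>\<theta>\<bar> < b"
  shows "\<bar>tan \<theta>\<bar> \<le> tan b"
proof -
  have "b < pi / 2" using b_le pi_gt_zero by linarith
  thus ?thesis using tan_mono_le[of \<theta> b] tan_mono_le[of "- b" \<theta>] assms
    by (simp add: abs_le_iff abs_less_iff)
qed

lemma billiard_iet_exch:
  assumes "\<bar>\<theta>\<bar> < b" "x \<in> {-1..<1}"
  shows "billiard_iet d \<theta> x = exch (tan \<theta>) x"
proof -
  have b2: "b < pi / 2" using b_le pi_gt_zero by linarith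
  have t: "\<bar>tan \<theta>\<bar> \<le> tan b" using assms(1) by (rule abs_tan_le)
  have at: "arctan (tan \<theta>) = \<theta>" using assms b2 by (intro arctan_tan) auto
  obtain j where j: "j \<in> {1..d}" "x \<in> {gm (tan \<theta>) (j - 1)..<gm (tan \<theta>) j}"
    by (rule ex_gm_interval[OF assms(2)])
  show ?thesis
    using billiard_iet_eq[OF d2, of \<theta> j x] exch_eq[OF t j] assms(1) j unfolding at b_def by simp
qed

text \<open>The map \<open>\<pi>\<close> lays the scaled intervals of states side by side and
  carries \<open>stair\<close> to \<open>exch t\<close>. The scale \<open>c\<close> allows any pair
  proportional to the lengths of \<open>gm_step\<close>.\<close>

lemma exch_gm_add:
  assumes "0 \<le> t" "t \<le> tan b" and c: "c > 0" "c * \<alpha> = 2 * t" "c * \<beta> = 2 * (sin b - t * cos b)"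
    and p: "(k, u) \<in> states \<alpha> \<beta>"
  defines "\<pi> \<equiv> \<lambda>(k, u). gm t (k - 1) + c * u"
  shows "exch t (\<pi> (k, u)) = \<pi> (stair \<alpha> \<beta> (k, u))"
proof -
  have k: "1 \<le> k" "k \<le> d" "0 \<le> u" "u < vv \<beta> k + hh \<alpha> k" using p by (auto simp: states_def)
  have sc: "hh (2 * t) i = c * hh \<alpha> i" "vv (2 * (sin b - t * cos b)) i = c * vv \<beta> i" for i
    by (simp_all only: hh_def vv_def c(2,3)[symmetric] mult.assoc)
  have step: "gm t j - gm t (j - 1) = c * (vv \<beta> j + hh \<alpha> j)" if "1 \<le> j" for j
    using gm_step[OF that, of t] unfolding sc by (simp add: algebra_simps)
  \<comment> \<open>The cosines cancel under \<open>k \<mapsto> d - k\<close>, leaving the length of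
    the left part of interval \<open>k\<close>.\<close>
  have sum: "gm t k + gm t (d - k) = c * hh \<alpha> k"
  proof -
    have "2 * real (d - k) * b = pi - 2 * real k * b"
      using two_d_b k by (simp add: of_nat_diff algebra_simps)
    hence "gm t k + gm t (d - k) = hh (2 * t) k" unfolding gm_eq by (simp add: hh_def)
    thus ?thesis by (simp add: sc)
  qed
  have "c * u < c * (vv \<beta> k + hh \<alpha> k)" using c k by simp
  hence "gm t (k - 1) + c * u < gm t k" using step[OF k(1)] by linarith
  hence "\<pi> (k, u) \<in> {gm t (k - 1)..<gm t k}" using k c by (simp add: \<pi>_def)
  hence ex: "exch t (\<pi> (k, u)) = c * u - gm t k"
    using exch_eq[of t k "\<pi> (k, u)"] k assms by (simp add: \<pi>_def)
  show ?thesis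
  proof (cases "u < hh \<alpha> k")
    case True
    hence "k \<noteq> d" using k by auto
    hence "c * u - gm t k = gm t (d - k - 1) + c * (u + vv \<beta> (d - k))"
      using step[of "d - k"] sum k hh_reflect[of k \<alpha>] by (simp add: algebra_simps)
    thus ?thesis using True unfolding ex by (simp add: stair_def \<pi>_def)
  next
    case False
    have "c * u - gm t k = gm t (d - k) + c * (u - hh \<alpha> k)" using sum by (simp add: algebra_simps)
    thus ?thesis using False unfolding ex by (simp add: stair_def \<pi>_def)
  qed
qed

text \<open>This is the \<open>t \<ge> 0\<close> for which \<open>\<alpha> : \<beta> = t : (sin b - t * cos b)\<close>.\<close>

definition slope :: "real \<times> real \<Rightarrow> real" where
  "slope p = fst p * sin b / (snd p + fst p * cos b)"

lemma slope_bounds: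
  assumes "\<alpha> \<ge> 0" "\<beta> \<ge> 0" "(\<alpha>, \<beta>) \<noteq> (0, 0)"
  shows "\<beta> + \<alpha> * cos b > 0" "0 \<le> slope (\<alpha>, \<beta>)" "slope (\<alpha>, \<beta>) \<le> tan b"
proof -
  show p: "\<beta> + \<alpha> * cos b > 0"
    using assms cos_b_pos by (cases "\<alpha> = 0") (auto intro: add_nonneg_pos)
  show "0 \<le> slope (\<alpha>, \<beta>)" using p assms sin_b_pos by (simp add: slope_def)
  show "slope (\<alpha>, \<beta>) \<le> tan b" using p assms sin_b_pos cos_b_pos
    by (simp add: slope_def tan_def field_simps)
qed

text \<open>A period of a state is a period of the corresponding point for the nonnegative slope,
  and the inverse map shares it; this covers both signs of \<open>t\<close>.\<close>

lemma periodic_exch: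
  assumes ab: "\<alpha> \<ge> 0" "\<beta> \<ge> 0" "(\<alpha>, \<beta>) \<noteq> (0, 0)" and per: "all_periodic \<alpha> \<beta>"
    and t: "\<bar>t\<bar> = slope (\<alpha>, \<beta>)" and x: "x \<in> {-1..<1}"
  shows "periodic_pt (exch t) x"
proof -
  define r where "r = slope (\<alpha>, \<beta>)"
  have p: "\<beta> + \<alpha> * cos b > 0" and r: "0 \<le> r" "r \<le> tan b" using slope_bounds[OF ab] by (simp_all add: r_def)
  define c where "c = 2 * sin b / (\<beta> + \<alpha> * cos b)"
  have c: "c > 0" "c * \<alpha> = 2 * r" "c * \<beta> = 2 * (sin b - r * cos b)"
    using p sin_b_pos by (simp_all add: c_def r_def slope_def field_simps)
  define \<pi> where "\<pi> = (\<lambda>(k, u). gm r (k - 1) + c * u)"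
  have semi: "exch r (\<pi> q) = \<pi> (stair \<alpha> \<beta> q)" if "q \<in> states \<alpha> \<beta>" for q
    using exch_gm_add[OF r c] that by (cases q) (simp add: \<pi>_def)
  obtain k where k: "k \<in> {1..d}" "x \<in> {gm r (k - 1)..<gm r k}" by (rule ex_gm_interval[OF x])
  define q where "q = (k, (x - gm r (k - 1)) / c)"
  have "gm r k - gm r (k - 1) = c * (vv \<beta> k + hh \<alpha> k)"
    using gm_step[of k r] k by (simp only: hh_def vv_def c(2,3)[symmetric] mult.assoc distrib_left atLeastAtMost_iff)
  hence "x - gm r (k - 1) < (vv \<beta> k + hh \<alpha> k) * c" using k by (simp add: mult.commute)
  hence q: "q \<in> states \<alpha> \<beta>" using k c
    by (simp add: q_def states_def divide_less_eq)
  have \<pi>q: "\<pi> q = x" using c by (simp add: \<pi>_def q_def)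
  have it: "(stair \<alpha> \<beta> ^^ n) q \<in> states \<alpha> \<beta> \<and> (exch r ^^ n) x = \<pi> ((stair \<alpha> \<beta> ^^ n) q)" for n
    by (induction n) (use \<pi>q q semi stair_in_states[OF ab(1,2)] in auto)
  obtain n where n: "n > 0" "(stair \<alpha> \<beta> ^^ n) q = q"
    using per q by (auto simp: all_periodic_def periodic_pt_def)
  have r1: "(exch r ^^ n) x = x" using it[of n] n \<pi>q by simp
  have "(exch (- r) ^^ n) x = x" using exch_funpow_uminus[of r x n] r r1 x by simp
  thus ?thesis using r1 n t by (auto simp: periodic_pt_def r_def[symmetric] abs_if split: if_splits)
qed

text \<open>Each piece of \<open>A\<close> within one interval is translated, and injectivity keeps
  the finitely many images disjoint.\<close>

lemma exch_image:
  assumes t: "\<bar>t\<bar> \<le> tan b" and A: "A \<in> sets lebesgue" "A \<subseteq> {-1..<1}"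
  shows "exch t ` A \<in> sets lebesgue" "exch t ` A \<subseteq> {-1..<1}"
    "measure lebesgue (exch t ` A) = measure lebesgue A"
proof -
  define J where "J j = A \<inter> {gm t (j - 1)..<gm t j}" for j
  have AJ: "A = (\<Union>j\<in>{1..d}. J j)"
    using ex_gm_interval[of _ t] A(2) by (auto simp: J_def) (metis atLeastAtMost_iff atLeastLessThan_iff subsetD)
  have Jf: "J j \<in> lmeasurable" for j
    unfolding J_def using A(1) by (intro bounded_set_imp_lmeasurable) (auto intro: bounded_subset[OF bounded_closed_interval])
  have img: "exch t ` J j = (+) (- gm t (j - 1) - gm t j) ` J j" if "j \<in> {1..d}" for j
    by (intro image_cong refl) (use exch_eq[OF t that] in \<open>auto simp: J_def\<close>)
  have If: "exch t ` J j \<in> lmeasurable" if "j \<in> {1..d}" for j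
    unfolding img[OF that] by (intro measurable_translation Jf)
  have Im: "measure lebesgue (exch t ` J j) = measure lebesgue (J j)" if "j \<in> {1..d}" for j
    unfolding img[OF that] by (rule measure_translation)
  have dJ: "J i \<inter> J j = {}" if "i \<in> {1..d}" "j \<in> {1..d}" "i < j" for i j
    using gm_mono[OF t, of i "j - 1"] that by (force simp: J_def)
  have dJ: "J i \<inter> J j = {}" if "i \<in> {1..d}" "j \<in> {1..d}" "i \<noteq> j" for i j
    using dJ[OF that(1,2)] dJ[OF that(2,1)] that(3) by (cases "i < j") auto
  have dI: "exch t ` J i \<inter> exch t ` J j = {}" if "i \<in> {1..d}" "j \<in> {1..d}" "i \<noteq> j" for i j
    using inj_on_image_Int[OF inj_on_exch[OF t], of "J i" "J j"] dJ[OF that] A(2) by (auto simp: J_def)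
  have IA: "exch t ` A = (\<Union>j\<in>{1..d}. exch t ` J j)" by (subst AJ) blast
  have "(\<Union>j\<in>{1..d}. exch t ` J j) \<in> lmeasurable" by (intro fmeasurable.finite_UN If) auto
  thus "exch t ` A \<in> sets lebesgue" unfolding IA by blast
  show "exch t ` A \<subseteq> {-1..<1}" using exch_in[OF t] A(2) by blast
  have "measure lebesgue (\<Union>j\<in>{1..d}. exch t ` J j) = (\<Sum>j\<in>{1..d}. measure lebesgue (exch t ` J j))"
    by (rule measure_UNION') (use If dI in \<open>auto simp: pairwise_def disjnt_def\<close>)
  also have "\<dots> = (\<Sum>j\<in>{1..d}. measure lebesgue (J j))" by (intro sum.cong refl Im)
  also have "\<dots> = measure lebesgue (\<Union>j\<in>{1..d}. J j)"
    by (rule measure_UNION'[symmetric]) (use Jf dJ in \<open>auto simp: pairwise_def disjnt_def\<close>)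
  finally show "measure lebesgue (exch t ` A) = measure lebesgue A" unfolding IA by (simp only: AJ[symmetric])
qed

end

section \<open>Rigidity from powers close to the identity\<close>

abbreviation "NL \<equiv> normalized_lebesgue"

lemma sets_NL: "A \<in> sets NL \<longleftrightarrow> A \<in> sets lebesgue \<and> A \<subseteq> {-1..<1}"
  by (auto simp: sets_normalized_lebesgue sets_restrict_space_iff)

lemma measure_NL:
  assumes "A \<in> sets NL"
  shows "measure NL A = measure lebesgue A / 2"
proof -
  have A: "A \<in> sets (lebesgue_on {-1..<1})" "A \<subseteq> {-1..<1}"
    using assms sets_NL by (auto simp: sets_normalized_lebesgue)
  have "measure (lebesgue_on {-1..<1}) B = measure lebesgue B" if "B \<subseteq> {-1..<1}" for B :: "real set"
    using that by (intro measure_restrict_space) auto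
  moreover have "emeasure (lebesgue_on {-1..<1}) {-1..<1::real} = 2"
    by (subst emeasure_restrict_space) auto
  ultimately show ?thesis unfolding normalized_lebesgue_def using A
    by (subst measure_uniform_measure) (auto simp: Int_absorb1)
qed

interpretation NL: prob_space NL by (rule prob_space_normalized_lebesgue)

lemma measurable_ident_NL [measurable]: "(\<lambda>x. x) \<in> borel_measurable NL"
proof -
  have "(\<lambda>x. x) \<in> borel_measurable (lebesgue_on {-1..<1::real})"
    by (intro measurable_restrict_space1 measurable_completion) simp
  thus ?thesis using measurable_cong_sets[OF sets_normalized_lebesgue refl] by blast
qed

text \<open>The inverse \<open>S\<close> turns preimages under \<open>T\<close> into images under
  \<open>S\<close>.\<close>

lemma measure_preserving_systemI:
  assumes M: "prob_space M" and T: "\<And>x. x \<in> space M \<Longrightarrow> T x \<in> space M"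
    and inv: "\<And>x. x \<in> space M \<Longrightarrow> S (T x) = x" "\<And>x. x \<in> space M \<Longrightarrow> T (S x) = x"
      "\<And>x. x \<in> space M \<Longrightarrow> S x \<in> space M"
    and img: "\<And>A. A \<in> sets M \<Longrightarrow> S ` A \<in> sets M" "\<And>A. A \<in> sets M \<Longrightarrow> measure M (S ` A) = measure M A"
  shows "measure_preserving_system M T"
proof -
  interpret prob_space M by fact
  have vi: "T -` A \<inter> space M = S ` A" if "A \<in> sets M" for A
    using sets.sets_into_space[OF that] inv by (auto simp: image_iff subset_iff) metis
  have TM: "T \<in> measurable M M" using T img vi by (auto intro!: measurableI)
  moreover have "distr M M T = M"
  proof (rule measure_eqI)
    show "emeasure (distr M M T) A = emeasure M A" if "A \<in> sets (distr M M T)" for A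
      using that TM img(2)[of A] by (simp add: emeasure_distr vi emeasure_eq_measure)
  qed simp
  ultimately show ?thesis using M by (simp add: measure_preserving_system_def)
qed

text \<open>A point of \<open>K\<close> displaced by at most \<delta> stays in \<open>U\<close>. So
  a point of \<open>A\<close> that leaves \<open>A\<close> starts in \<open>A - K\<close> or in the
  bad set, or ends in \<open>U - A\<close>. The factor 2 covers the other difference, of equal
  measure by invariance.\<close>

lemma measure_sym_diff_funpow_le:
  fixes T :: "real \<Rightarrow> real"
  assumes img: "\<And>A. A \<in> sets NL \<Longrightarrow> T ` A \<in> sets NL" "\<And>A. A \<in> sets NL \<Longrightarrow> measure NL (T ` A) = measure NL A"
    and A: "A \<in> sets NL"
    and B: "{x \<in> space NL. \<bar>(T ^^ s) x - x\<bar> > \<delta>} \<in> sets NL"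
    and K: "K \<in> sets NL" "K \<subseteq> A" and U: "U \<in> sets NL" "A \<subseteq> U"
    and sep: "\<And>x z. x \<in> K \<Longrightarrow> z \<in> space NL \<Longrightarrow> \<bar>z - x\<bar> \<le> \<delta> \<Longrightarrow> z \<in> U"
  shows "measure NL (sym_diff ((T ^^ s) ` A) A)
    \<le> 2 * (measure NL (A - K) + measure NL {x \<in> space NL. \<bar>(T ^^ s) x - x\<bar> > \<delta>} + measure NL (U - A))"
proof -
  define Bad where "Bad = {x \<in> space NL. \<bar>(T ^^ s) x - x\<bar> > \<delta>}"
  have imgs: "(T ^^ n) ` C \<in> sets NL \<and> measure NL ((T ^^ n) ` C) = measure NL C" if "C \<in> sets NL" for C n
  proof (induction n)
    case (Suc n)
    have "(T ^^ Suc n) ` C = T ` ((T ^^ n) ` C)" by (auto simp: image_image)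
    thus ?case using Suc img by simp
  qed (use that in simp)
  let ?R = "(T ^^ s) ` A"
  have R: "?R \<in> sets NL" "measure NL ?R = measure NL A" using imgs[OF A] by auto
  have Bs: "Bad \<in> sets NL" using B by (simp add: Bad_def)
  have "?R - A \<subseteq> ((T ^^ s) ` (A - K)) \<union> ((T ^^ s) ` Bad) \<union> (U - A)"
  proof
    fix z assume z: "z \<in> ?R - A"
    then obtain x where x: "x \<in> A" "z = (T ^^ s) x" by auto
    have zs: "z \<in> space NL" using z sets.sets_into_space[OF R(1)] by auto
    have xs: "x \<in> space NL" using x sets.sets_into_space[OF A(1)] by auto
    show "z \<in> ((T ^^ s) ` (A - K)) \<union> ((T ^^ s) ` Bad) \<union> (U - A)"
    proof (cases "x \<in> K \<and> x \<notin> Bad")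
      case True
      hence "\<bar>z - x\<bar> \<le> \<delta>" using x xs unfolding Bad_def by auto
      thus ?thesis using sep[of x z] True zs z by auto
    qed (use x in auto)
  qed
  hence "measure NL (?R - A) \<le> measure NL (((T ^^ s) ` (A - K)) \<union> ((T ^^ s) ` Bad) \<union> (U - A))"
    by (rule NL.finite_measure_mono) (use imgs[of "A - K"] imgs[of Bad] Bs A K U in auto)
  also have "\<dots> \<le> measure NL ((T ^^ s) ` (A - K)) + measure NL ((T ^^ s) ` Bad) + measure NL (U - A)"
    using imgs[of "A - K"] imgs[of Bad] Bs A K U
    by (intro order_trans[OF measure_Un_le] add_mono measure_Un_le) auto
  also have "\<dots> = measure NL (A - K) + measure NL Bad + measure NL (U - A)"
    using imgs[of "A - K"] imgs[of Bad] Bs A K by simp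
  finally have 1: "measure NL (?R - A) \<le> measure NL (A - K) + measure NL Bad + measure NL (U - A)" .
  have 2: "measure NL (A - ?R) = measure NL (?R - A)"
    using NL.finite_measure_Diff'[OF A R(1)] NL.finite_measure_Diff'[OF R(1) A] R(2)
    by (simp add: Int_commute)
  have "measure NL (sym_diff ?R A) \<le> measure NL (?R - A) + measure NL (A - ?R)"
    using A R by (intro measure_Un_le) auto
  thus ?thesis using 1 2 by (simp add: Bad_def)
qed

text \<open>Approximating \<open>A\<close> from inside by a compact set and from outside by an open
  set, which lie at a positive distance from each other's complement, reduces rigidity to small
  displacement off a small set.\<close>

lemma rigid_normalized_lebesgueI:
  fixes T :: "real \<Rightarrow> real"
  assumes mp: "measure_preserving_system NL T"
    and img: "\<And>A. A \<in> sets NL \<Longrightarrow> T ` A \<in> sets NL" "\<And>A. A \<in> sets NL \<Longrightarrow> measure NL (T ` A) = measure NL A"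
    and close: "\<And>n. \<exists>s\<ge>n. measure NL {x \<in> space NL. \<bar>(T ^^ s) x - x\<bar> > 1 / real (Suc n)} < 1 / real (Suc n)"
  shows "rigid NL T"
proof -
  have "\<forall>n. \<exists>s. s \<ge> n \<and> measure NL {x \<in> space NL. \<bar>(T ^^ s) x - x\<bar> > 1 / real (Suc n)} < 1 / real (Suc n)"
    using close by blast
  from choice[OF this] obtain s where s: "\<And>n. s n \<ge> n"
    and cl: "\<And>n. measure NL {x \<in> space NL. \<bar>(T ^^ s n) x - x\<bar> > 1 / real (Suc n)} < 1 / real (Suc n)"
    by blast
  have "filterlim s at_top sequentially"
    by (rule filterlim_at_top_mono[OF filterlim_ident]) (use s in auto)
  have [measurable]: "T \<in> measurable NL NL" using mp by (simp add: measure_preserving_system_def)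
  have "(T ^^ n) \<in> measurable NL NL" for n by (rule measurable_compose_n) simp
  hence [measurable]: "(T ^^ n) \<in> borel_measurable NL" for n
    using measurable_compose[OF _ measurable_ident_NL] by blast
  have B: "{x \<in> space NL. \<bar>(T ^^ n) x - x\<bar> > \<delta>} \<in> sets NL" for n \<delta>
    by measurable
  have "(\<lambda>n. measure NL (sym_diff ((T ^^ s n) ` A) A)) \<longlonglongrightarrow> 0" if A: "A \<in> sets NL" for A
  proof (rule LIMSEQ_I)
    fix r :: real assume "r > 0"
    \<comment> \<open>Three error terms below \<open>\<eta>\<close>, doubled, add up to less than
      \<open>r\<close>.\<close>
    define \<eta> where "\<eta> = r / 6"
    have \<eta>: "\<eta> > 0" using \<open>r > 0\<close> by (simp add: \<eta>_def)
    have AL: "A \<in> sets lebesgue" "A \<subseteq> {-1..<1}" using A sets_NL by auto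
    obtain V where V: "open V" "A \<subseteq> V" "V - A \<in> lmeasurable" "emeasure lebesgue (V - A) < ennreal \<eta>"
      using sets_lebesgue_outer_open[OF AL(1) \<eta>] .
    obtain K where K: "closed K" "K \<subseteq> A" "A - K \<in> lmeasurable" "emeasure lebesgue (A - K) < ennreal \<eta>"
      using sets_lebesgue_inner_closed[OF AL(1) \<eta>] .
    have KN: "K \<in> sets NL" using K AL sets_NL by (auto intro: borel_closed)
    have UN: "V \<inter> {-1..<1} \<in> sets NL" using V sets_NL by (auto intro: borel_open)
    have mK: "measure NL (A - K) < \<eta>"
    proof -
      have "measure lebesgue (A - K) < \<eta>"
        using K(4) \<eta> by (simp add: emeasure_eq_measure2[OF K(3)] ennreal_less_iff)
      thus ?thesis using measure_NL[of "A - K"] A KN \<eta> by auto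
    qed
    have mU: "measure NL (V \<inter> {-1..<1} - A) < \<eta>"
    proof -
      have "measure lebesgue (V - A) < \<eta>"
        using V(4) \<eta> by (simp add: emeasure_eq_measure2[OF V(3)] ennreal_less_iff)
      moreover have "measure lebesgue (V \<inter> {-1..<1} - A) \<le> measure lebesgue (V - A)"
        by (rule measure_mono_fmeasurable) (use V UN A sets_NL in auto)
      ultimately show ?thesis using measure_NL[of "V \<inter> {-1..<1} - A"] A UN \<eta> by auto
    qed
    have "compact K" using K AL bounded_subset[OF bounded_closed_interval[of "-1" 1]] compact_eq_bounded_closed
      by (meson atLeastLessThan_subseteq_atLeastAtMost_iff bounded_subset order_refl subset_trans)
    moreover have "closed (- V)" "K \<inter> - V = {}" using V K by auto
    ultimately obtain \<rho> where \<rho>: "\<rho> > 0" "\<And>x z. x \<in> K \<Longrightarrow> z \<in> - V \<Longrightarrow> \<rho> \<le> dist x z"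
      using separate_compact_closed[of K "- V"] by blast
    obtain N where N: "1 / real (Suc N) < min \<rho> \<eta>" using \<rho> \<eta> nat_approx_posE[of "min \<rho> \<eta>"] by auto
    show "\<exists>N. \<forall>n\<ge>N. norm (measure NL (sym_diff ((T ^^ s n) ` A) A) - 0) < r"
    proof (intro exI[of _ N] allI impI)
      fix n assume "N \<le> n"
      hence n: "1 / real (Suc n) < min \<rho> \<eta>"
        using N order.strict_trans1[of "1 / real (Suc n)" "1 / real (Suc N)"] by (simp add: frac_le)
      have "measure NL (sym_diff ((T ^^ s n) ` A) A) \<le>
         2 * (measure NL (A - K) + measure NL {x \<in> space NL. \<bar>(T ^^ s n) x - x\<bar> > 1 / real (Suc n)}
            + measure NL (V \<inter> {-1..<1} - A))"
      proof (rule measure_sym_diff_funpow_le[OF img A B KN K(2) UN])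
        show "A \<subseteq> V \<inter> {-1..<1}" using V AL by auto
        show "z \<in> V \<inter> {-1..<1}" if "x \<in> K" "z \<in> space NL" "\<bar>z - x\<bar> \<le> 1 / real (Suc n)" for x z
          using \<rho>(2)[of x z] that n by (force simp: dist_real_def abs_minus_commute)
      qed auto
      also have "\<dots> < r" using mK mU cl[of n] n by (simp add: \<eta>_def)
      finally show "norm (measure NL (sym_diff ((T ^^ s n) ` A) A) - 0) < r" by simp
    qed
  qed
  thus ?thesis using mp \<open>filterlim s at_top sequentially\<close> by (auto simp: rigid_def)
qed

context regular_polygon
begin

lemma exch_image_NL:
  assumes "\<bar>t\<bar> \<le> tan b" "A \<in> sets NL"
  shows "exch t ` A \<in> sets NL" "measure NL (exch t ` A) = measure NL A"
  using exch_image[OF assms(1), of A] assms(2) by (auto simp: sets_NL measure_NL)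

lemma measure_preserving_exch:
  assumes "\<bar>t\<bar> \<le> tan b"
  shows "measure_preserving_system NL (exch t)"
  by (rule measure_preserving_systemI[where S = "exch (- t)"])
    (use assms exch_in[of t] exch_in[of "- t"] exch_uminus[of t] exch_uminus[of "- t"]
      exch_image_NL[of "- t"] prob_space_normalized_lebesgue in auto)

lemma measurable_exch_funpow:
  assumes "\<bar>t\<bar> \<le> tan b"
  shows "(exch t ^^ n) \<in> borel_measurable NL"
proof -
  have "exch t \<in> measurable NL NL"
    using measure_preserving_exch[OF assms] by (simp add: measure_preserving_system_def)
  hence "(exch t ^^ n) \<in> measurable NL NL" by (rule measurable_compose_n)
  thus ?thesis using measurable_compose[OF _ measurable_ident_NL] by blast
qed

section \<open>Dependence of powers on the slope, near pointwise periodic maps\<close>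

lemma tendsto_gm: "\<tau> \<longlonglongrightarrow> t \<Longrightarrow> (\<lambda>k. gm (\<tau> k) j) \<longlonglongrightarrow> gm t j"
  unfolding gm_eq by (intro tendsto_intros)

text \<open>An orbit avoiding the endpoints runs, for nearby parameters, through the same intervals,
  and their translations vary continuously.\<close>

lemma tendsto_exch_funpow:
  assumes t: "\<bar>t\<bar> \<le> tan b" and \<tau>: "\<And>k. \<bar>\<tau> k\<bar> \<le> tan b" "\<tau> \<longlonglongrightarrow> t"
    and x: "x \<in> {-1..<1}" and reg: "\<And>i j. i < s \<Longrightarrow> j \<le> d \<Longrightarrow> (exch t ^^ i) x \<noteq> gm t j"
  shows "(\<lambda>k. (exch (\<tau> k) ^^ s) x) \<longlonglongrightarrow> (exch t ^^ s) x"
  using reg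
proof (induction s)
  case (Suc s)
  define z where "z = (exch t ^^ s) x"
  define zk where "zk k = (exch (\<tau> k) ^^ s) x" for k
  have lim: "zk \<longlonglongrightarrow> z" using Suc by (simp add: zk_def[abs_def] z_def)
  have "z \<in> {-1..<1}" using exch_funpow_in[OF t x] by (simp add: z_def)
  then obtain j where j: "j \<in> {1..d}" "z \<in> {gm t (j - 1)..<gm t j}" by (rule ex_gm_interval)
  have "j - 1 \<le> d" using j by auto
  hence "z \<noteq> gm t (j - 1)" using Suc.prems[of s "j - 1"] by (simp add: z_def)
  hence "z - gm t (j - 1) > 0" "gm t j - z > 0" using j by auto
  moreover have "(\<lambda>k. zk k - gm (\<tau> k) (j - 1)) \<longlonglongrightarrow> z - gm t (j - 1)" "(\<lambda>k. gm (\<tau> k) j - zk k) \<longlonglongrightarrow> gm t j - z"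
    by (intro tendsto_diff lim tendsto_gm \<tau>)+
  ultimately have ev: "\<forall>\<^sub>F k in sequentially. zk k - gm (\<tau> k) (j - 1) > 0 \<and> gm (\<tau> k) j - zk k > 0"
    by (intro eventually_conj order_tendstoD(1))
  have "(\<lambda>k. zk k - gm (\<tau> k) (j - 1) - gm (\<tau> k) j) \<longlonglongrightarrow> z - gm t (j - 1) - gm t j"
    by (intro tendsto_diff lim tendsto_gm \<tau>)
  moreover have "\<forall>\<^sub>F k in sequentially. zk k - gm (\<tau> k) (j - 1) - gm (\<tau> k) j = exch (\<tau> k) (zk k)"
    using ev by eventually_elim (use exch_eq[OF \<tau>(1) j(1)] in auto)
  ultimately have "(\<lambda>k. exch (\<tau> k) (zk k)) \<longlonglongrightarrow> z - gm t (j - 1) - gm t j"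
    by (rule Lim_transform_eventually)
  thus ?case using exch_eq[OF t j] by (simp add: z_def zk_def)
qed simp

text \<open>Iterates are injective, so each of the finitely many excluded equations has at most one
  solution.\<close>

lemma AE_regular_orbit:
  assumes t: "\<bar>t\<bar> \<le> tan b"
  shows "AE x in NL. \<forall>i<s. \<forall>j\<le>d. (exch t ^^ i) x \<noteq> gm t j"
proof -
  define E where "E = (\<Union>i\<in>{..<s}. \<Union>j\<in>{..d}. {x \<in> {-1..<1}. (exch t ^^ i) x = gm t j})"
  have "finite {x \<in> {-1..<1}. (exch t ^^ i) x = gm t j}" for i j
  proof -
    have "inj_on (exch t ^^ i) {-1..<1}" by (rule inj_on_exch_funpow[OF t])
    hence "finite ((exch t ^^ i) -` {gm t j} \<inter> {-1..<1})" by (intro finite_vimage_IntI) auto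
    moreover have "(exch t ^^ i) -` {gm t j} \<inter> {-1..<1} = {x \<in> {-1..<1}. (exch t ^^ i) x = gm t j}" by auto
    ultimately show ?thesis by simp
  qed
  hence "finite E" by (auto simp: E_def)
  hence n: "E \<in> null_sets lebesgue" using negligible_finite negligible_iff_null_sets by blast
  hence EN: "E \<in> sets NL" by (auto simp: sets_NL E_def)
  have "measure lebesgue E = 0" using n by (simp add: measure_eq_0_null_sets)
  hence "E \<in> null_sets NL" using EN measure_NL[OF EN] by (simp add: null_sets_def NL.emeasure_eq_measure)
  hence "AE x in NL. x \<notin> E" by (rule AE_not_in)
  thus ?thesis by (rule AE_mp) (auto simp: E_def intro!: AE_I2)
qed

text \<open>Periods may vary from point to point, but the points fixed by the power
  \<open>fact i\<close> increase with \<open>i\<close> to the whole interval. One such power is thus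
  the identity off a set of measure below \<epsilon> / 2, and for this fixed power the parameter can
  be perturbed.\<close>

lemma near_periodic:
  assumes t: "\<bar>t\<bar> \<le> tan b" and per: "\<And>x. x \<in> {-1..<1} \<Longrightarrow> periodic_pt (exch t) x" and e: "\<epsilon> > 0"
  shows "\<exists>\<delta>>0. \<forall>t'. \<bar>t'\<bar> \<le> tan b \<and> \<bar>t' - t\<bar> < \<delta> \<longrightarrow>
           (\<exists>s\<ge>N. measure NL {x \<in> space NL. \<bar>(exch t' ^^ s) x - x\<bar> > \<epsilon>} < \<epsilon>)"
proof -
  note [measurable] = measurable_exch_funpow[OF t]
  define C where "C i = {x \<in> space NL. (exch t ^^ fact i) x = x}" for i
  have CN: "C i \<in> sets NL" for i unfolding C_def by measurable
  have mult: "(exch t ^^ (m * n)) x = x" if "(exch t ^^ n) x = x" for m n x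
    using that by (induction m) (auto simp: funpow_add)
  have "incseq C"
  proof (rule monoI)
    fix i j :: nat assume "i \<le> j"
    then obtain m where "(fact j :: nat) = m * fact i" using fact_dvd[of i j] by (metis dvd_def mult.commute)
    thus "C i \<subseteq> C j" using mult by (auto simp: C_def)
  qed
  have "(\<Union>i. C i) = space NL"
  proof
    show "space NL \<subseteq> (\<Union>i. C i)"
    proof
      fix x assume "x \<in> space NL"
      then obtain n where n: "n > 0" "(exch t ^^ n) x = x" using per[of x] by (auto simp: periodic_pt_def)
      obtain m where "(fact n :: nat) = m * n" using n dvd_fact[of n n] by (metis dvd_def mult.commute One_nat_def Suc_leI order_refl)
      hence "x \<in> C n" using \<open>x \<in> space NL\<close> mult[OF n(2)] by (simp add: C_def)
      thus "x \<in> (\<Union>i. C i)" by blast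
    qed
  qed (auto simp: C_def)
  hence "(\<lambda>i. measure NL (C i)) \<longlonglongrightarrow> 1"
    using NL.finite_Lim_measure_incseq[of C] CN \<open>incseq C\<close> NL.prob_space by auto
  hence "\<forall>\<^sub>F i in sequentially. measure NL (C i) > 1 - \<epsilon> / 2"
    by (rule order_tendstoD(1)) (use e in simp)
  hence "\<forall>\<^sub>F i in sequentially. measure NL (C i) > 1 - \<epsilon> / 2 \<and> i \<ge> N"
    by (rule eventually_conj) (rule eventually_ge_at_top)
  then obtain i where i: "measure NL (C i) > 1 - \<epsilon> / 2" "i \<ge> N"
    using eventually_happens by fastforce
  define s where "s = (fact i :: nat)"
  have sN: "s \<ge> N" using i fact_ge_self[of i] by (simp add: s_def)
  define B where "B t' = {x \<in> space NL. \<bar>(exch t' ^^ s) x - x\<bar> > \<epsilon>}" for t'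
  have BN: "B t' \<in> sets NL" if "\<bar>t'\<bar> \<le> tan b" for t'
  proof -
    note [measurable] = measurable_exch_funpow[OF that]
    show ?thesis unfolding B_def by measurable
  qed
  have "\<exists>\<delta>>0. \<forall>t'. \<bar>t'\<bar> \<le> tan b \<and> \<bar>t' - t\<bar> < \<delta> \<longrightarrow> measure NL (B t') < \<epsilon>"
  proof (rule ccontr)
    assume neg: "\<not> ?thesis"
    have "\<exists>t'. \<bar>t'\<bar> \<le> tan b \<and> \<bar>t' - t\<bar> < 1 / real (Suc k) \<and> \<not> measure NL (B t') < \<epsilon>" for k
      using neg by (auto dest!: spec[of _ "1 / real (Suc k)"])
    then obtain \<tau> where \<tau>: "\<And>k. \<bar>\<tau> k\<bar> \<le> tan b" "\<And>k. \<bar>\<tau> k - t\<bar> < 1 / real (Suc k)"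
      "\<And>k. measure NL (B (\<tau> k)) \<ge> \<epsilon>" by (metis not_less)
    have "(\<lambda>k. \<tau> k - t) \<longlonglongrightarrow> 0"
      by (rule Lim_null_comparison[OF _ lim_inverse_n'[THEN LIMSEQ_Suc]])
        (use \<tau>(2) in \<open>auto intro!: always_eventually less_imp_le\<close>)
    hence lim: "\<tau> \<longlonglongrightarrow> t" by (simp add: LIM_zero_iff)
    have [measurable]: "B (\<tau> k) \<inter> C i \<in> sets NL" for k using BN[OF \<tau>(1)] CN by blast
    \<comment> \<open>On \<open>C i\<close> the limiting power is the identity, so almost every
      point is outside \<open>B (\<tau> k)\<close> for all large \<open>k\<close>; dominated
      convergence applies.\<close>
    have "(\<lambda>k. integral\<^sup>L NL (indicat_real (B (\<tau> k) \<inter> C i))) \<longlonglongrightarrow> integral\<^sup>L NL (\<lambda>_. 0 :: real)"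
    proof (rule integral_dominated_convergence[where w = "\<lambda>_. 1"])
      show "AE x in NL. (\<lambda>k. indicat_real (B (\<tau> k) \<inter> C i) x) \<longlonglongrightarrow> 0"
        using AE_regular_orbit[OF t, of s]
      proof (rule AE_mp, intro AE_I2 impI)
        fix x assume x: "x \<in> space NL" and reg: "\<forall>i<s. \<forall>j\<le>d. (exch t ^^ i) x \<noteq> gm t j"
        show "(\<lambda>k. indicat_real (B (\<tau> k) \<inter> C i) x) \<longlonglongrightarrow> 0"
        proof (cases "x \<in> C i")
          case True
          have "(\<lambda>k. (exch (\<tau> k) ^^ s) x) \<longlonglongrightarrow> (exch t ^^ s) x"
            by (rule tendsto_exch_funpow[OF t \<tau>(1) lim]) (use x reg in auto)
          hence "(\<lambda>k. \<bar>(exch (\<tau> k) ^^ s) x - x\<bar>) \<longlonglongrightarrow> \<bar>x - x\<bar>"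
            using True by (intro tendsto_intros) (simp add: C_def s_def)
          hence "\<forall>\<^sub>F k in sequentially. \<bar>(exch (\<tau> k) ^^ s) x - x\<bar> < \<epsilon>"
            by (rule order_tendstoD(2)) (use e in simp)
          hence "\<forall>\<^sub>F k in sequentially. indicat_real (B (\<tau> k) \<inter> C i) x = 0"
            by eventually_elim (auto simp: B_def)
          thus ?thesis by (rule tendsto_eventually)
        qed simp
      qed
    qed (auto simp: indicator_def)
    moreover have "B (\<tau> k) \<inter> C i \<inter> {-1..<1} = B (\<tau> k) \<inter> C i" for k by (auto simp: C_def)
    ultimately have "(\<lambda>k. measure NL (B (\<tau> k) \<inter> C i)) \<longlonglongrightarrow> 0" by simp
    hence "\<forall>\<^sub>F k in sequentially. measure NL (B (\<tau> k) \<inter> C i) < \<epsilon> / 2"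
      by (rule order_tendstoD(2)) (use e in simp)
    then obtain k where k: "measure NL (B (\<tau> k) \<inter> C i) < \<epsilon> / 2"
      using eventually_happens by fastforce
    have Bk: "B (\<tau> k) \<in> sets NL" by (rule BN[OF \<tau>(1)])
    have "measure NL (B (\<tau> k) - C i) \<le> measure NL (space NL - C i)"
      using Bk sets.compl_sets[OF CN[of i]] sets.sets_into_space[OF Bk] by (intro NL.finite_measure_mono) auto
    also have "\<dots> < \<epsilon> / 2" using NL.prob_compl[OF CN[of i]] i by simp
    finally have "measure NL (B (\<tau> k)) < \<epsilon>"
      using k NL.finite_measure_Diff'[OF Bk CN[of i]] by simp
    thus False using \<tau>(3)[of k] by simp
  qed
  thus ?thesis using sN unfolding B_def by blast
qed

end

lemma rigid_cong:
  assumes eq: "\<And>x. x \<in> space M \<Longrightarrow> T x = T' x" and T: "\<And>x. x \<in> space M \<Longrightarrow> T x \<in> space M"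
    and "rigid M T"
  shows "rigid M T'"
proof -
  have it: "(T ^^ n) x = (T' ^^ n) x \<and> (T ^^ n) x \<in> space M" if "x \<in> space M" for n x
    using that by (induction n) (auto simp: T eq[symmetric])
  have "(T ^^ n) ` A = (T' ^^ n) ` A" if "A \<in> sets M" for n A
    using it sets.sets_into_space[OF that] by (intro image_cong) auto
  moreover have "T \<in> measurable M M \<longleftrightarrow> T' \<in> measurable M M" by (rule measurable_cong) (rule eq)
  moreover have "distr M M T = distr M M T'" by (rule distr_cong) (auto simp: eq)
  ultimately show ?thesis using assms(3) by (auto simp: rigid_def measure_preserving_system_def)
qed

lemma even_length_history: "even (length (history m q n))"
  and le_length_history: "n \<le> length (history m q n)"
  by (induction n) (auto simp: history_def)

context regular_polygon
begin

section \<open>Renormalization\<close>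

definition cone :: "real \<times> real \<Rightarrow> bool" where
  "cone p \<longleftrightarrow> fst p \<ge> 0 \<and> snd p \<ge> 0 \<and> p \<noteq> (0, 0)"

definition twist_v :: "nat \<Rightarrow> real \<times> real \<Rightarrow> real \<times> real" where
  "twist_v n p = (fst p, snd p + 2 * cos b * real n * fst p)"

definition twist_h :: "nat \<Rightarrow> real \<times> real \<Rightarrow> real \<times> real" where
  "twist_h n p = (fst p + 2 * cos b * real n * snd p, snd p)"

text \<open>The head of the list is the outermost twist, since the first steps of \<open>g\<close>
  are undone last. Lists of odd length, such as \<open>history m q n @ [m n]\<close>, end with a
  vertical twist.\<close>

fun act :: "nat list \<Rightarrow> real \<times> real \<Rightarrow> real \<times> real" where
  "act [] p = p"
| "act [m] p = twist_v m p"
| "act (m # q # xs) p = twist_v m (twist_h q (act xs p))"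

text \<open>Evenness of \<open>xs\<close> keeps the entries of \<open>ys\<close> in their roles as
  vertical and horizontal exponents.\<close>

lemma act_append: "even (length xs) \<Longrightarrow> act (xs @ ys) p = act xs (act ys p)"
  by (induction xs p rule: act.induct) auto

lemma cone_twist_v: "cone p \<Longrightarrow> cone (twist_v n p)"
  and cone_twist_h: "cone p \<Longrightarrow> cone (twist_h n p)"
  using cos_b_pos by (cases p; auto simp: cone_def twist_v_def twist_h_def add_nonneg_eq_0_iff)+

lemma cone_act: "cone p \<Longrightarrow> cone (act xs p)"
  by (induction xs p rule: act.induct) (auto simp: cone_twist_v cone_twist_h)

lemma twist_Suc:
  "twist_v (Suc n) p = twist_v 1 (twist_v n p)" "twist_h (Suc n) p = twist_h 1 (twist_h n p)"
  by (simp_all add: twist_v_def twist_h_def algebra_simps)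

lemma all_periodic_twist_v:
  "cone p \<Longrightarrow> all_periodic (fst p) (snd p) \<Longrightarrow> all_periodic (fst (twist_v n p)) (snd (twist_v n p))"
proof (induction n)
  case (Suc n)
  have "cone (twist_v n p)" using Suc.prems by (simp add: cone_twist_v)
  thus ?case using Suc all_periodic_vertical[of "fst (twist_v n p)" "snd (twist_v n p)"]
    unfolding twist_Suc(1) by (simp add: twist_v_def[of "Suc 0"] cone_def)
qed (simp add: twist_v_def)

lemma all_periodic_twist_h:
  "cone p \<Longrightarrow> all_periodic (fst p) (snd p) \<Longrightarrow> all_periodic (fst (twist_h n p)) (snd (twist_h n p))"
proof (induction n)
  case (Suc n)
  have "cone (twist_h n p)" using Suc.prems by (simp add: cone_twist_h)
  thus ?case using Suc all_periodic_horizontal[of "fst (twist_h n p)" "snd (twist_h n p)"]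
    unfolding twist_Suc(2) by (simp add: twist_h_def[of "Suc 0"] cone_def)
qed (simp add: twist_h_def)

lemma all_periodic_act:
  "cone p \<Longrightarrow> all_periodic (fst p) (snd p) \<Longrightarrow> all_periodic (fst (act xs p)) (snd (act xs p))"
proof (induction xs p rule: act.induct)
  case (3 m q xs p)
  thus ?case by (simp add: all_periodic_twist_v all_periodic_twist_h cone_twist_h cone_act)
qed (auto intro: all_periodic_twist_v)

lemma continuous_act: "continuous_on UNIV (act xs)"
proof (induction xs rule: induct_list012)
  case 1 thus ?case by simp
next
  case (2 m) thus ?case by (simp add: twist_v_def) (intro continuous_intros)
next
  case (3 m q xs) thus ?case by (simp add: twist_v_def twist_h_def) (intro continuous_intros)
qed

text \<open>\<open>p\<close> represents \<open>y\<close> in homogeneous coordinates; \<open>(0, 1)\<close> and \<open>(1, 0)\<close> are the cusps \<open>\<infinity>\<close> and \<open>0\<close>.\<close>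

definition rep :: "real \<times> real \<Rightarrow> real \<Rightarrow> bool" where
  "rep p y \<longleftrightarrow> fst p > 0 \<and> cos b * snd p = fst p * y"

lemma lam_b: "lam d = 2 * (cos b)\<^sup>2"
  by (simp add: lam_alt b_def)

lemma lam_ge_1: "lam d \<ge> 1"
proof -
  have "cos (2 * b) \<ge> 0" using b_pos b_le by (intro cos_ge_zero) auto
  thus ?thesis using cos_double_cos[of b] by (simp add: lam_b)
qed

text \<open>The \<open>2 * cos b\<close> of the twist and the \<open>cos b\<close> in
  \<open>rep\<close> multiply to \<open>lam d\<close>: \<open>n\<close> steps of the first branch of
  \<open>g\<close> are undone.\<close>

lemma rep_twist_v: "rep p z \<Longrightarrow> rep (twist_v n p) (z + real n * lam d)"
  by (simp add: rep_def twist_v_def lam_b power2_eq_square algebra_simps)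

text \<open>In the coordinate this is the \<open>n\<close>-th iterate of the inverse of the second
  branch; the positivity assumption keeps the first component positive.\<close>

lemma rep_twist_h:
  assumes "rep p w" "1 + 2 * real n * w > 0"
  shows "rep (twist_h n p) (w / (1 + 2 * real n * w))"
proof -
  have "fst (twist_h n p) = fst p + 2 * real n * (cos b * snd p)" by (simp add: twist_h_def)
  also have "\<dots> = fst p * (1 + 2 * real n * w)" using assms(1) by (simp add: rep_def algebra_simps)
  finally have "fst (twist_h n p) = fst p * (1 + 2 * real n * w)" .
  thus ?thesis using assms by (simp add: rep_def) (simp add: twist_h_def)
qed

text \<open>Clearing denominators in \<open>y_param\<close> shows that
  \<open>y_param d \<theta>\<close> times the absolute tangent is
  \<open>cos b * (sin b - cos b * \<bar>tan \<theta>\<bar>)\<close>, the proportion that defines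
  \<open>slope\<close>.\<close>

lemma abs_tan_eq_slope:
  assumes "0 < \<bar>\<theta>\<bar>" "\<bar>\<theta>\<bar> < b" "rep p (y_param d \<theta>)" "snd p \<ge> 0"
  shows "\<bar>tan \<theta>\<bar> = slope p"
proof -
  have p: "fst p > 0" "cos b * snd p = fst p * y_param d \<theta>" using assms(3) by (auto simp: rep_def)
  have "tan \<theta> \<noteq> 0"
  proof -
    have "\<bar>\<theta>\<bar> < pi / 2" using assms(2) b_le pi_gt_zero by linarith
    thus ?thesis using assms(1) tan_gt_zero[of \<theta>] tan_gt_zero[of "- \<theta>"] by (cases "\<theta> > 0") auto
  qed
  hence t: "\<bar>tan \<theta>\<bar> > 0" by simp
  have pd: "pi / real d = 2 * b" using d2 by (simp add: b_def)
  have "y_param d \<theta> = (sin (2 * b) / \<bar>tan \<theta>\<bar> - 2 * (cos b)\<^sup>2) / 2"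
    using lam_b by (simp add: y_param_def lam_def pd)
  hence y: "y_param d \<theta> * \<bar>tan \<theta>\<bar> = cos b * (sin b - cos b * \<bar>tan \<theta>\<bar>)"
    using t unfolding sin_double by (simp add: power2_eq_square field_simps)
  have "cos b * (snd p * \<bar>tan \<theta>\<bar>) = fst p * (y_param d \<theta> * \<bar>tan \<theta>\<bar>)" using p(2) by (simp add: algebra_simps)
  also have "\<dots> = cos b * (fst p * (sin b - cos b * \<bar>tan \<theta>\<bar>))" by (simp add: y)
  finally have "snd p * \<bar>tan \<theta>\<bar> = fst p * (sin b - cos b * \<bar>tan \<theta>\<bar>)" using cos_b_pos by simp
  moreover have "snd p + fst p * cos b > 0" using p assms(4) cos_b_pos by (simp add: add_nonneg_pos)
  ultimately show ?thesis by (simp add: slope_def field_simps)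
qed

text \<open>A single index serves as lower bound for the exponent and as inverse of the precision, so that
  rigidity follows as soon as \<open>almost_id t n\<close> holds for unboundedly many \<open>n\<close>.\<close>

definition almost_id :: "real \<Rightarrow> nat \<Rightarrow> bool" where
  "almost_id t n \<longleftrightarrow> (\<exists>s\<ge>n. measure NL {x \<in> space NL. \<bar>(exch t ^^ s) x - x\<bar> > 1 / real (Suc n)} < 1 / real (Suc n))"

lemma almost_id_mono:
  assumes "\<bar>t\<bar> \<le> tan b" "almost_id t n" "k \<le> n"
  shows "almost_id t k"
proof -
  note [measurable] = measurable_exch_funpow[OF assms(1)]
  obtain s where s: "s \<ge> n" "measure NL {x \<in> space NL. \<bar>(exch t ^^ s) x - x\<bar> > 1 / real (Suc n)} < 1 / real (Suc n)"
    using assms(2) by (auto simp: almost_id_def)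
  have le: "1 / real (Suc n) \<le> 1 / real (Suc k)" using assms(3) by (simp add: frac_le)
  have "measure NL {x \<in> space NL. \<bar>(exch t ^^ s) x - x\<bar> > 1 / real (Suc k)}
     \<le> measure NL {x \<in> space NL. \<bar>(exch t ^^ s) x - x\<bar> > 1 / real (Suc n)}"
    using le by (intro NL.finite_measure_mono) (auto simp del: space_normalized_lebesgue)
  thus ?thesis using s le assms(3) by (auto simp: almost_id_def intro!: exI[of _ s])
qed

lemma rigid_exch:
  assumes t: "\<bar>t\<bar> \<le> tan b" and "\<And>n. almost_id t n"
  shows "rigid NL (exch t)"
  using assms(2) exch_image_NL[OF t] measure_preserving_exch[OF t]
  by (intro rigid_normalized_lebesgueI) (auto simp: almost_id_def)

text \<open>The image of \<open>p0\<close> under \<open>act xs\<close> is again all periodic, and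
  \<open>slope\<close> after \<open>act xs\<close> is continuous at \<open>p0\<close>. Since
  \<open>slope\<close> fixes \<open>t\<close> only up to sign, \<open>near_periodic\<close> is
  applied at both \<open>r\<close> and \<open>- r\<close>.\<close>

lemma almost_id_near_cusp:
  assumes p0: "cone p0" "all_periodic (fst p0) (snd p0)"
  shows "\<exists>\<delta>>0. \<forall>p t. cone p \<and> dist p p0 < \<delta> \<and> \<bar>t\<bar> = slope (act xs p) \<longrightarrow> almost_id t n"
proof -
  define r where "r = slope (act xs p0)"
  obtain \<alpha> \<beta> where ab: "act xs p0 = (\<alpha>, \<beta>)" by force
  have cab: "\<alpha> \<ge> 0" "\<beta> \<ge> 0" "(\<alpha>, \<beta>) \<noteq> (0, 0)"
    using cone_act[OF p0(1), of xs] by (auto simp: cone_def ab)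
  have rb: "0 \<le> r" "r \<le> tan b" and pos: "\<beta> + \<alpha> * cos b > 0"
    using slope_bounds[OF cab] by (auto simp: r_def ab)
  have per: "periodic_pt (exch t) x" if "\<bar>t\<bar> = r" "x \<in> {-1..<1}" for t x
    using periodic_exch[OF cab, of t x] all_periodic_act[OF p0, of xs] that by (simp add: ab r_def)
  have "\<exists>\<delta>>0. \<forall>t'. \<bar>t'\<bar> \<le> tan b \<and> \<bar>t' - t\<bar> < \<delta> \<longrightarrow> almost_id t' n" if "\<bar>t\<bar> = r" for t
    using near_periodic[of t "1 / real (Suc n)" n] per that rb by (simp add: almost_id_def)
  from this[of r] this[of "- r"] obtain \<delta>1 \<delta>2 where
    \<delta>1: "\<delta>1 > 0" "\<And>t'. \<bar>t'\<bar> \<le> tan b \<Longrightarrow> \<bar>t' - r\<bar> < \<delta>1 \<Longrightarrow> almost_id t' n" and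
    \<delta>2: "\<delta>2 > 0" "\<And>t'. \<bar>t'\<bar> \<le> tan b \<Longrightarrow> \<bar>t' + r\<bar> < \<delta>2 \<Longrightarrow> almost_id t' n" using rb by auto
  have "isCont (act xs) p0" using continuous_act continuous_on_eq_continuous_at open_UNIV by blast
  hence "isCont (\<lambda>p. slope (act xs p)) p0"
    using pos unfolding slope_def by (intro continuous_intros) (auto simp: ab)
  then obtain \<delta> where \<delta>: "\<delta> > 0" "\<And>p. dist p p0 < \<delta> \<Longrightarrow> dist (slope (act xs p)) r < min \<delta>1 \<delta>2"
    using \<delta>1 \<delta>2 unfolding continuous_at_eps_delta r_def by (metis min_less_iff_conj)
  have "almost_id t n" if t: "cone p" "dist p p0 < \<delta>" "\<bar>t\<bar> = slope (act xs p)" for p t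
  proof -
    have "slope (act xs p) \<le> tan b"
      using slope_bounds(3)[of "fst (act xs p)" "snd (act xs p)"] cone_act[OF t(1), of xs] by (simp add: cone_def)
    hence "\<bar>t\<bar> \<le> tan b" using t by simp
    moreover have "\<bar>\<bar>t\<bar> - r\<bar> < min \<delta>1 \<delta>2" using \<delta>(2)[OF t(2)] t(3) by (simp add: dist_real_def)
    ultimately show ?thesis using \<delta>1(2)[of t] \<delta>2(2)[of t] by (cases "t \<ge> 0") auto
  qed
  thus ?thesis using \<delta>(1) by blast
qed

section \<open>Runs of \<open>g\<close> and the coordinates of their starting points\<close>

lemma g_run_above:
  assumes "\<And>i. i < n \<Longrightarrow> lam d < (g d ^^ i) z"
  shows "(g d ^^ n) z = z - real n * lam d" "n > 0 \<Longrightarrow> real n * lam d < z"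
proof -
  have *: "(g d ^^ n) z = z - real n * lam d \<and> (n > 0 \<longrightarrow> real n * lam d < z)"
    using assms
  proof (induction n)
    case (Suc n)
    have "(g d ^^ n) z = z - real n * lam d" "lam d < (g d ^^ n) z"
      using Suc.IH Suc.prems by (simp, blast)
    thus ?case by (simp add: g_def[of d "(g d ^^ n) z"] algebra_simps)
  qed simp
  show "(g d ^^ n) z = z - real n * lam d" "n > 0 \<Longrightarrow> real n * lam d < z" using * by auto
qed

text \<open>Each step lowers the reciprocal by 2. Expressing the start \<open>w\<close> through the
  end \<open>v\<close> gives the form required by \<open>rep_twist_h\<close>.\<close>

lemma g_run_below:
  assumes "\<And>i. i < n \<Longrightarrow> 0 < (g d ^^ i) w \<and> (g d ^^ i) w < 1 / 2"
  defines "v \<equiv> (g d ^^ n) w"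
  shows "1 + 2 * real n * v > 0" "w = v / (1 + 2 * real n * v)" "n > 0 \<Longrightarrow> 0 < v"
proof -
  have *: "1 + 2 * real n * v > 0 \<and> w = v / (1 + 2 * real n * v) \<and> (n > 0 \<longrightarrow> 0 < v)"
    using assms(1) unfolding v_def
  proof (induction n)
    case (Suc n)
    define v where "v = (g d ^^ n) w"
    define v' where "v' = v / (1 - 2 * v)"
    have v: "0 < v" "v < 1 / 2" using Suc.prems[of n] by (auto simp: v_def)
    have gv: "(g d ^^ Suc n) w = v'" using v lam_ge_1 by (simp add: v'_def g_def flip: v_def)
    have v': "v' > 0" "v = v' / (1 + 2 * v')" using v by (auto simp: v'_def field_simps)
    have "w = v / (1 + 2 * real n * v)" using Suc by (simp add: v_def)
    also have "\<dots> = v' / (1 + 2 * real (Suc n) * v')"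
    proof -
      have "1 + 2 * v' > 0" "1 + 2 * real (Suc n) * v' > 0" using v' by (auto simp: add_pos_nonneg)
      thus ?thesis unfolding v'(2) using v'(1) by (simp add: divide_simps) (simp add: algebra_simps)
    qed
    finally show ?case unfolding gv using v'(1) by (simp add: add_pos_nonneg)
  qed simp
  show "1 + 2 * real n * v > 0" "w = v / (1 + 2 * real n * v)" "n > 0 \<Longrightarrow> 0 < v" using * by auto
qed

context
  fixes y :: real and m q :: "nat \<Rightarrow> nat"
  assumes m0: "m 0 = 0" and q0: "q 0 = 0"
    and above: "\<And>k n. N_sum m q k \<le> n \<Longrightarrow> n < N_sum m q k + m (k + 1) \<Longrightarrow> lam d < (g d ^^ n) y"
    and below: "\<And>k n. N_sum m q k + m (k + 1) \<le> n \<Longrightarrow> n < N_sum m q k + m (k + 1) + q (k + 1)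
      \<Longrightarrow> 0 < (g d ^^ n) y \<and> (g d ^^ n) y < 1 / 2"
begin

lemma run_above:
  assumes "i < m (k + 1)"
  shows "lam d < (g d ^^ i) ((g d ^^ N_sum m q k) y)"
  using above[of k "i + N_sum m q k"] assms by (simp add: funpow_add)

lemma run_below:
  assumes "i < q (k + 1)"
  shows "0 < (g d ^^ i) ((g d ^^ (N_sum m q k + m (k + 1))) y) \<and> (g d ^^ i) ((g d ^^ (N_sum m q k + m (k + 1))) y) < 1 / 2"
  using below[of k "i + (N_sum m q k + m (k + 1))"] assms by (simp add: funpow_add)

lemma rep_twist_v_run:
  assumes "rep p ((g d ^^ (N_sum m q k + m (k + 1))) y)"
  shows "rep (twist_v (m (k + 1)) p) ((g d ^^ N_sum m q k) y)"
proof -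
  have "(g d ^^ (N_sum m q k + m (k + 1))) y = (g d ^^ N_sum m q k) y - real (m (k + 1)) * lam d"
    using g_run_above(1)[of "m (k + 1)" "(g d ^^ N_sum m q k) y", OF run_above]
    by (simp add: add.commute[of "N_sum m q k"] funpow_add)
  thus ?thesis using rep_twist_v[OF assms, of "m (k + 1)"] by simp
qed

text \<open>The last pair of the history is the innermost and acts on \<open>p\<close> first, so the
  induction must allow arbitrary \<open>p\<close>. The initial pair is \<open>[0, 0]\<close> and
  acts trivially.\<close>

lemma rep_act_history:
  "rep p ((g d ^^ N_sum m q k) y) \<Longrightarrow> rep (act (history m q (Suc k)) p) y"
proof (induction k arbitrary: p)
  case 0
  thus ?case by (simp add: N_sum_def history_def m0 q0 twist_v_def twist_h_def)
next
  case (Suc k)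
  define w where "w = (g d ^^ (N_sum m q k + m (k + 1))) y"
  define v where "v = (g d ^^ N_sum m q (Suc k)) y"
  have v: "v = (g d ^^ q (k + 1)) w"
  proof -
    have "N_sum m q (Suc k) = q (k + 1) + (N_sum m q k + m (k + 1))" by (simp add: N_sum_def)
    thus ?thesis unfolding v_def w_def by (simp only: funpow_add o_apply)
  qed
  note run = g_run_below[of "q (k + 1)" w, OF run_below[of _ k, folded w_def], folded v]
  have "rep (twist_h (q (k + 1)) p) w"
    using rep_twist_h[of p v "q (k + 1)"] Suc.prems run(1,2) by (simp add: v_def)
  hence "rep (twist_v (m (k + 1)) (twist_h (q (k + 1)) p)) ((g d ^^ N_sum m q k) y)"
    unfolding w_def by (rule rep_twist_v_run)
  hence "rep (act (history m q (Suc k)) (act [m (k + 1), q (k + 1)] p)) y" by (intro Suc.IH) simp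
  moreover have "history m q (Suc (Suc k)) = history m q (Suc k) @ [m (k + 1), q (k + 1)]"
    by (simp add: history_def)
  ultimately show ?case by (simp only: act_append[OF even_length_history])
qed

text \<open>A run of \<open>m n\<close> subtractions of \<open>lam d \<ge> 1\<close> can only start
  at some \<open>z > m n\<close>, so \<open>(cos b / z, 1)\<close> is near the cusp
  \<open>(0, 1)\<close>.\<close>

lemma rep_large_m:
  assumes "m n > 0"
  shows "\<exists>z > real (m n). rep (act (history m q n) (cos b / z, 1)) y"
proof -
  obtain k where k: "n = Suc k" using assms m0 by (cases n) auto
  define z where "z = (g d ^^ N_sum m q k) y"
  have "real (m n) * lam d < z"
    using g_run_above(2)[of "m (k + 1)" z] run_above[of _ k] assms by (simp add: z_def k)
  moreover have "real (m n) * 1 \<le> real (m n) * lam d" using lam_ge_1 by (intro mult_left_mono) auto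
  ultimately have z: "z > real (m n)" by simp
  hence "z > 0" by (rule le_less_trans[rotated]) simp
  hence "rep (cos b / z, 1) z" using cos_b_pos by (simp add: rep_def)
  thus ?thesis using rep_act_history[of _ k] z by (auto simp: z_def k)
qed

text \<open>A run of \<open>q n\<close> steps in the second branch starts at some
  \<open>w < 1 / (2 * q n)\<close>, near the cusp \<open>(1, 0)\<close>. It begins after the run of
  length \<open>m n\<close>, hence the extra list entry.\<close>

lemma rep_large_q:
  assumes "q n > 0"
  shows "\<exists>w. 0 < w \<and> w < 1 / (2 * real (q n)) \<and> rep (act (history m q n @ [m n]) (1, w / cos b)) y"
proof -
  obtain k where k: "n = Suc k" using assms q0 by (cases n) auto
  define w where "w = (g d ^^ (N_sum m q k + m (k + 1))) y"
  define v where "v = (g d ^^ q (k + 1)) w"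
  note run = g_run_below[of "q (k + 1)" w, OF run_below[of _ k, folded w_def], folded v_def]
  have v: "v > 0" using run(3) assms k by simp
  have "v / (1 + 2 * real (q n) * v) < 1 / (2 * real (q n))" "0 < v / (1 + 2 * real (q n) * v)"
    using v assms by (simp_all add: field_simps add_pos_pos)
  hence w: "0 < w" "w < 1 / (2 * real (q n))" using run(2) by (simp_all add: k)
  have "rep (1, w / cos b) w" using cos_b_pos by (simp add: rep_def)
  hence "rep (act (history m q n) (twist_v (m n) (1, w / cos b))) y"
    using rep_act_history[of _ k] rep_twist_v_run[of _ k] by (simp add: w_def k)
  thus ?thesis using w by (auto simp: act_append[OF even_length_history])
qed

end

text \<open>Being within the radius \<delta> or \<open>\<delta>'\<close> of a cusp becomes
  \<open>z > cos b / \<delta>\<close> or a bound on \<open>w\<close>. A threshold sees only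
  \<open>xs\<close>, so the precision is encoded as \<open>length xs\<close>, which is unbounded
  along the histories.\<close>

lemma exists_thresholds:
  "\<exists>F G :: nat list \<Rightarrow> real. (\<forall>xs. F xs \<ge> 0) \<and> (\<forall>xs. G xs \<ge> 0) \<and>
    (\<forall>xs z t. z > F xs \<and> \<bar>t\<bar> = slope (act xs (cos b / z, 1)) \<longrightarrow> almost_id t (length xs)) \<and>
    (\<forall>xs w t. 0 < w \<and> w * G xs < 1 / 2 \<and> \<bar>t\<bar> = slope (act xs (1, w / cos b)) \<longrightarrow> almost_id t (length xs))"
proof -
  have "\<forall>xs. \<exists>\<delta>>0. \<forall>p t. cone p \<and> dist p (0, 1) < \<delta> \<and> \<bar>t\<bar> = slope (act xs p) \<longrightarrow> almost_id t (length xs)"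
    using almost_id_near_cusp[of "(0, 1)"] all_periodic_0_1 by (simp add: cone_def)
  from choice[OF this] obtain \<delta> where \<delta>: "\<And>xs. \<delta> xs > 0"
    "\<And>xs p t. cone p \<Longrightarrow> dist p (0, 1) < \<delta> xs \<Longrightarrow> \<bar>t\<bar> = slope (act xs p) \<Longrightarrow> almost_id t (length xs)" by blast
  have "\<forall>xs. \<exists>\<delta>>0. \<forall>p t. cone p \<and> dist p (1, 0) < \<delta> \<and> \<bar>t\<bar> = slope (act xs p) \<longrightarrow> almost_id t (length xs)"
    using almost_id_near_cusp[of "(1, 0)"] all_periodic_1_0 by (simp add: cone_def)
  from choice[OF this] obtain \<delta>' where \<delta>': "\<And>xs. \<delta>' xs > 0"
    "\<And>xs p t. cone p \<Longrightarrow> dist p (1, 0) < \<delta>' xs \<Longrightarrow> \<bar>t\<bar> = slope (act xs p) \<Longrightarrow> almost_id t (length xs)" by blast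
  have 1: "cos b / \<delta> xs \<ge> 0" "1 / (2 * cos b * \<delta>' xs) \<ge> 0" for xs
    using \<delta>(1)[of xs] \<delta>'(1)[of xs] cos_b_pos by simp_all
  have 2: "almost_id t (length xs)"
    if "z > cos b / \<delta> xs" "\<bar>t\<bar> = slope (act xs (cos b / z, 1))" for xs z t
  proof -
    have z: "z > 0" using that(1) 1(1)[of xs] by linarith
    have "cos b / z < \<delta> xs" using that(1) z \<delta>(1)[of xs] by (simp add: field_simps)
    thus ?thesis using z cos_b_pos that(2)
      by (intro \<delta>(2)[of "(cos b / z, 1)"]) (auto simp: cone_def dist_Pair_Pair dist_real_def)
  qed
  have 3: "almost_id t (length xs)"
    if "0 < w" "w * (1 / (2 * cos b * \<delta>' xs)) < 1 / 2" "\<bar>t\<bar> = slope (act xs (1, w / cos b))" for xs w t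
  proof -
    have "w / cos b < \<delta>' xs" using that(1,2) cos_b_pos \<delta>'(1)[of xs] by (simp add: field_simps)
    thus ?thesis using cos_b_pos that(1,3)
      by (intro \<delta>'(2)[of "(1, w / cos b)"]) (auto simp: cone_def dist_Pair_Pair dist_real_def)
  qed
  show ?thesis
    by (rule exI[of _ "\<lambda>xs. cos b / \<delta> xs"], rule exI[of _ "\<lambda>xs. 1 / (2 * cos b * \<delta>' xs)"]) (use 1 2 3 in blast)
qed

end

theorem proposition12:
  fixes d :: nat
  assumes "d \<ge> 2"
  shows "\<exists>F G :: nat list \<Rightarrow> real.
    (\<forall>xs. F xs \<ge> 0) \<and> (\<forall>xs. G xs \<ge> 0) \<and>
    (\<forall>(y :: real) (m :: nat \<Rightarrow> nat) (q :: nat \<Rightarrow> nat).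
       y > 0 \<longrightarrow> m 0 = 0 \<longrightarrow> q 0 = 0 \<longrightarrow>
       (\<forall>k n. N_sum m q k \<le> n \<and> n < N_sum m q k + m (k + 1) \<longrightarrow>
          lam d < (g d ^^ n) y) \<longrightarrow>
       (\<forall>k n. N_sum m q k + m (k + 1) \<le> n \<and> n < N_sum m q k + m (k + 1) + q (k + 1) \<longrightarrow>
          0 < (g d ^^ n) y \<and> (g d ^^ n) y < 1 / 2) \<longrightarrow>
       (\<exists>\<^sub>\<infinity>n. real (m n) > F (history m q n) \<or> real (q n) > G (history m q n @ [m n])) \<longrightarrow>
       (\<forall>\<theta>. 0 < \<bar>\<theta>\<bar> \<and> \<bar>\<theta>\<bar> < pi / (2 * real d) \<and> y = y_param d \<theta> \<longrightarrow>
          rigid normalized_lebesgue (billiard_iet d \<theta>)))"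
proof -
  interpret regular_polygon d by standard fact
  obtain F G :: "nat list \<Rightarrow> real" where FG: "\<And>xs. F xs \<ge> 0" "\<And>xs. G xs \<ge> 0"
    and F: "\<And>xs z t. z > F xs \<Longrightarrow> \<bar>t\<bar> = slope (act xs (cos b / z, 1)) \<Longrightarrow> almost_id t (length xs)"
    and G: "\<And>xs w t. 0 < w \<Longrightarrow> w * G xs < 1 / 2 \<Longrightarrow> \<bar>t\<bar> = slope (act xs (1, w / cos b)) \<Longrightarrow> almost_id t (length xs)"
    using exists_thresholds by blast
  show ?thesis
  proof (rule exI[of _ F], rule exI[of _ G], intro conjI allI impI)
    fix y :: real and m q :: "nat \<Rightarrow> nat" and \<theta> :: real
    assume m0: "m 0 = 0" and q0: "q 0 = 0"
      and A: "\<forall>k n. N_sum m q k \<le> n \<and> n < N_sum m q k + m (k + 1) \<longrightarrow> lam d < (g d ^^ n) y"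
      and B: "\<forall>k n. N_sum m q k + m (k + 1) \<le> n \<and> n < N_sum m q k + m (k + 1) + q (k + 1) \<longrightarrow>
          0 < (g d ^^ n) y \<and> (g d ^^ n) y < 1 / 2"
      and inf: "\<exists>\<^sub>\<infinity>n. real (m n) > F (history m q n) \<or> real (q n) > G (history m q n @ [m n])"
      and \<theta>: "0 < \<bar>\<theta>\<bar> \<and> \<bar>\<theta>\<bar> < pi / (2 * real d) \<and> y = y_param d \<theta>"
    have th: "0 < \<bar>\<theta>\<bar>" "\<bar>\<theta>\<bar> < b" "y = y_param d \<theta>" using \<theta> by (auto simp: b_def)
    have t: "\<bar>tan \<theta>\<bar> \<le> tan b" by (rule abs_tan_le[OF th(2)])
    have tan_slope: "\<bar>tan \<theta>\<bar> = slope (act xs p)" if "cone p" "rep (act xs p) y" for xs p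
      using abs_tan_eq_slope[OF th(1,2)] that cone_act[OF that(1), of xs] th(3) by (auto simp: cone_def)
    have "almost_id (tan \<theta>) n0" for n0
    proof -
      obtain n where n: "n \<ge> n0" "real (m n) > F (history m q n) \<or> real (q n) > G (history m q n @ [m n])"
        using inf by (auto simp: INFM_nat_le)
      \<comment> \<open>Histories grow with \<open>n\<close>, so the precision obtained is at least
        \<open>n0\<close>.\<close>
      have len: "n0 \<le> length (history m q n)" using le_length_history[of n m q] n(1) by simp
      from n(2) have "\<exists>k\<ge>n0. almost_id (tan \<theta>) k"
      proof
        assume mF: "real (m n) > F (history m q n)"
        \<comment> \<open>The threshold is nonnegative, so the run is nonempty, as
          \<open>rep_large_m\<close> requires.\<close>
        have "real (m n) > 0" using FG(1) mF le_less_trans by blast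
        hence "\<exists>z > real (m n). rep (act (history m q n) (cos b / z, 1)) y"
          by (intro rep_large_m[where m = m and q = q and y = y and n = n]) (use m0 q0 A B in auto)
        then obtain z where z: "z > real (m n)" "rep (act (history m q n) (cos b / z, 1)) y" by blast
        have "cone (cos b / z, 1)" using z(1) cos_b_pos by (simp add: cone_def)
        hence "almost_id (tan \<theta>) (length (history m q n))"
          using F[of "history m q n" z] mF z tan_slope by simp
        thus ?thesis using len by blast
      next
        assume qG: "real (q n) > G (history m q n @ [m n])"
        have q: "real (q n) > 0" using FG(2) qG le_less_trans by blast
        hence "\<exists>w. 0 < w \<and> w < 1 / (2 * real (q n)) \<and> rep (act (history m q n @ [m n]) (1, w / cos b)) y"
          by (intro rep_large_q[where m = m and q = q and y = y and n = n]) (use m0 q0 A B in auto)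
        then obtain w where w: "0 < w" "w < 1 / (2 * real (q n))"
          "rep (act (history m q n @ [m n]) (1, w / cos b)) y" by blast
        have "w * G (history m q n @ [m n]) \<le> w * real (q n)" using qG w(1) by simp
        also have "\<dots> < 1 / 2" using w(2) q by (simp add: field_simps)
        finally have "w * G (history m q n @ [m n]) < 1 / 2" .
        moreover have "cone (1, w / cos b)" using w(1) cos_b_pos by (simp add: cone_def)
        ultimately have "almost_id (tan \<theta>) (length (history m q n @ [m n]))"
          using G w tan_slope by blast
        thus ?thesis using len by (intro exI[of _ "length (history m q n @ [m n])"]) simp
      qed
      thus ?thesis using almost_id_mono[OF t] by blast
    qed
    hence "rigid normalized_lebesgue (exch (tan \<theta>))" by (rule rigid_exch[OF t])
    thus "rigid normalized_lebesgue (billiard_iet d \<theta>)"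
      by (rule rigid_cong[rotated 2]) (use billiard_iet_exch[OF th(2)] exch_in[OF t] in auto)
  qed (use FG in auto)
qed

end
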